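(* Let $u$ be a sequence of length $\ell$ with $r$ distinct letters, and let $N$ be an integer greater than $\operatorname{Sat}(n,u)$. Let $\mathcal{P},\mathcal{P}^+,\mathcal{P}^-$ be the families of subsets of $[n]\times[N]$ defined in the context, write $\mathcal{P}\cup\mathcal{P}^{\pm}=\mathcal{P}\cup\mathcal{P}^+\cup\mathcal{P}^-$, and for $(i,j)\in[n]\times[N]$ let $$A_{i,j}=\{P'\in\mathcal{P}:(i,j)\in P'\},\qquad A^{+}_{i,j}=\{P'\in\mathcal{P}^{+}:(i,j)\in P'\},\qquad A^{-}_{i,j}=\{P'\in\mathcal{P}^{-}:(i,j)\in P'\}.$$ Note that $A_{i,j}\neq\varnothing$ for all $(i,j)$, and that $|P'|=\ell$ for every $P'\in\mathcal{P}\cup\mathcal{P}^{\pm}$. Consider variables $x_{i,j}$ for $(i,j)\in[n]\times[N]$ and $y_{P'}$ for $P'\in\mathcal{P}\cup\mathcal{P}^{\pm}$, put $f(P')=\sum_{(i,j)\in P'}x_{i,j}$, and impose the constraints (with $x_{i,t}$ read as $0$ when $t\notin[N]$): $$\begin{aligned} & x_{i,j}\in\{0,1\} && \forall (i,j)\in[n]\times[N],\\ & y_{P'}\in\{0,1\} && \forall P'\in\mathcal{P}\cup\mathcal{P}^{\pm},\\ & f(P')<\ell && \forall P'\in\mathcal{P},\\ & (\ell-1)y_{P'}-f(P')\le 0 && \forall P'\in\mathcal{P}\cup\mathcal{P}^{\pm},\\ & y_{P'}-f(P')\ge -\ell+2 && \forall P'\in\mathcal{P}\cup\mathcal{P}^{\pm},\\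 & \sum_{P'\in A_{i,j}\cup A^+_{i,j}}y_{P'}-\sum_{t=i+1}^{n}x_{t,j}+\sum_{t=j-r+1}^{j+r-2}x_{i,t}\ge 0 && \forall (i,j)\in[n]\times[N],\\ & \sum_{P'\in A_{i,j}\cup A^+_{i,j}}y_{P'}-\sum_{t=1}^{i-1}x_{t,j}+\sum_{t=j-r+2}^{j+r-1}x_{i,t}\ge 0 && \forall (i,j)\in[n]\times[N],\\ & \sum_{P'\in A_{i,j}\cup A^-_{i,j}}y_{P'}-\sum_{t=i+1}^{n}x_{t,j}+\sum_{t=j-r+2}^{j+r-1}x_{i,t}\ge 0 && \forall (i,j)\in[n]\times[N],\\ & \sum_{P'\in A_{i,j}\cup A^-_{i,j}}y_{P'}-\sum_{t=1}^{i-1}x_{t,j}+\sum_{t=j-r+1}^{j+r-2}x_{i,t}\ge 0 && \forall (i,j)\in[n]\times[N],\\ & \sum_{i=1}^{n}x_{i,j}\le 1 && \forall j\in[N],\\ & \sum_{i=1}^{n}x_{i,j}\ge\sum_{i=1}^{n}x_{i,j+1} && \forall j\in[N-1],\\ & \sum_{t=j}^{j+r-1}x_{i,t}\le 1 && \forall (i,j)\in[n]\times[N-r+1],\\ & x_{i,i}=1 && \forall i\in[r-1]. \end{aligned}$$ Then the minimum of $\sum_{i,j}x_{i,j}$ over all assignments of the variables satisfying these constraints equals $\operatorname{Sat}(n,u)$.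
   Context: For a positive integer $m$, $[m]=\{1,\dots,m\}$. Two sequences are isomorphic if one is obtained from the other by a one-to-one renaming of letters. A copy of $u$ in a sequence $s$ is a (not necessarily contiguous) subsequence of $s$ isomorphic to $u$; $s$ avoids $u$ if it contains no copy of $u$. A sequence is $r$-sparse if any $r$ consecutive letters in it are pairwise distinct. With $r$ the number of distinct letters of $u$, a finite sequence $s$ with letters in an alphabet $A$ is $u$-saturated if $s$ is $r$-sparse, $s$ avoids $u$, and inserting any letter of $A$ at an arbitrary position of $s$ (including the beginning and the end) yields a sequence that is not $r$-sparse or that contains a copy of $u$. $\operatorname{Sat}(n,u)$ is the minimum length of a $u$-saturated sequence on $n$ letters. A 0-1 matrix is a matrix whose entries are $0$ or $1$. Let $u$ have length $\ell$ and $r$ distinct letters. A $u$-pattern is an $r\times\ell$ 0-1 matrix with a single $1$ in each column such that the sequence of row indices of the ones, listed from left to right, is isomorphic to $u$. A $u^+$-pattern is an $r\times(\ell-1)$ 0-1 matrix in which every column has exactly one $1$, except for a single column $c$ which has two ones, such that the sequence of row indices of the ones, listed from left to right, where the one in column $c$ with the higher row index is placed first, is isomorphic to $u$. A $u^-$-pattern is defined similarly, except that the one in column $c$ with the lower row index is placed first. $\mathcal{P}$ is the set of all index sets $P'\subset[n]\times[N]$ that form a copy of some $u$-pattern $P$ in the $n\times N$ all-ones matrix, i.e. $P'=\{(i_p,j_q):P_{p,q}=1\}$ for some $u$-pattern $P$, some rows $i_1<\dots<i_r$ in $[n]$ and some columns $j_1<\dots<j_\ell$ in $[N]$. $\mathcal{P}^+$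 and $\mathcal{P}^-$ are defined analogously using $u^+$-patterns and $u^-$-patterns respectively (with $\ell-1$ columns $j_1<\dots<j_{\ell-1}$).
   Formalization: Assumes r ≥ 2 and n ≥ r (for r = 1, ℓ ≥ 2 the minimum is 0 but Sat > 0); the smaller row index is read first in u⁺-patterns and the larger in u⁻ (as written, u = aba, n = 2 is infeasible); r-sparse means equal letters are at distance ≥ r, also in short sequences. *)

theory Defs
  imports Main "HOL-Library.Sublist"
begin

definition isomorphic :: "'a list \<Rightarrow> 'b list \<Rightarrow> bool" where
  "isomorphic s t \<longleftrightarrow> (\<exists>f. inj_on f (set s) \<and> t = map f s)"

definition contains_copy :: "'a list \<Rightarrow> 'b list \<Rightarrow> bool" where
  "contains_copy s u \<longleftrightarrow> (\<exists>t. subseq t s \<and> isomorphic u t)"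

abbreviation avoids :: "'a list \<Rightarrow> 'b list \<Rightarrow> bool" where
  "avoids s u \<equiv> \<not> contains_copy s u"

(* The window take r (drop i s) is cut off at the end of s, so equal letters are at distance
   at least r also when s is shorter than r.  Otherwise any repetitive word of length r - 1
   would be r-sparse vacuously, and for r >= 3 it would be u-saturated. *)
definition sparse :: "nat \<Rightarrow> 'a list \<Rightarrow> bool" where
  "sparse r s \<longleftrightarrow> (\<forall>i. distinct (take r (drop i s)))"

definition insert_at :: "nat \<Rightarrow> 'a \<Rightarrow> 'a list \<Rightarrow> 'a list" where
  "insert_at k a s = take k s @ a # drop k s"

definition saturated :: "'a set \<Rightarrow> 'b list \<Rightarrow> 'a list \<Rightarrow> bool" where
  "saturated A u s \<longleftrightarrow>
     set s \<subseteq> A \<and> sparse (card (set u)) s \<and> avoids s u \<and>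
     (\<forall>a\<in>A. \<forall>k\<le>length s.
        \<not> sparse (card (set u)) (insert_at k a s) \<or> contains_copy (insert_at k a s) u)"

(* The n letters are the alphabet {1..n}; a saturated sequence need not use all of them. *)
definition Sat :: "nat \<Rightarrow> 'a list \<Rightarrow> nat" where
  "Sat n u = (LEAST k. \<exists>s :: nat list. saturated {1..n} u s \<and> length s = k)"


(* Matrices are functions of a row and a column index, both counted from 1, row 1 on top;
   only the values on {1..r} x {1..m} matter. *)
type_synonym matrix = "nat \<Rightarrow> nat \<Rightarrow> nat"

definition zero_one :: "nat \<Rightarrow> nat \<Rightarrow> matrix \<Rightarrow> bool" where
  "zero_one r m P \<longleftrightarrow> (\<forall>p\<in>{1..r}. \<forall>q\<in>{1..m}. P p q \<in> {0, 1})"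

definition col_ones :: "nat \<Rightarrow> matrix \<Rightarrow> nat \<Rightarrow> nat set" where
  "col_ones r P q = {p\<in>{1..r}. P p q = 1}"

(* Row indices of the ones, column by column from left to right; within a column from the
   top row to the bottom row (rows_down), respectively from bottom to top (rows_up). *)
definition rows_down :: "nat \<Rightarrow> nat \<Rightarrow> matrix \<Rightarrow> nat list" where
  "rows_down r m P = concat (map (\<lambda>q. sorted_list_of_set (col_ones r P q)) [1..<m+1])"

definition rows_up :: "nat \<Rightarrow> nat \<Rightarrow> matrix \<Rightarrow> nat list" where
  "rows_up r m P = concat (map (\<lambda>q. rev (sorted_list_of_set (col_ones r P q))) [1..<m+1])"

definition u_pattern :: "'a list \<Rightarrow> matrix \<Rightarrow> bool" where
  "u_pattern u P \<longleftrightarrow>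
     (let r = card (set u); l = length u in
       zero_one r l P \<and> (\<forall>q\<in>{1..l}. card (col_ones r P q) = 1) \<and>
       isomorphic u (rows_down r l P))"

definition one_double_column :: "nat \<Rightarrow> nat \<Rightarrow> matrix \<Rightarrow> bool" where
  "one_double_column r m P \<longleftrightarrow>
     (\<exists>c\<in>{1..m}. card (col_ones r P c) = 2 \<and>
        (\<forall>q\<in>{1..m} - {c}. card (col_ones r P q) = 1))"

(* In a u+-pattern the one in the HIGHER row of the double column is read first.  Higher is
   taken as in the picture of the matrix, nearer to the top, i.e. the smaller index.  Only
   this orientation fits the program below: there the constraint that uses the +-patterns
   with x(t,j), t > i, has the window j-r+1..j+r-2, which is the sparsity window for
   inserting i BEFORE the letter t of column j.  With the opposite orientation the program
   is infeasible for u = aba, n = 2, although Sat 2 u = 2. *)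
definition u_plus_pattern :: "'a list \<Rightarrow> matrix \<Rightarrow> bool" where
  "u_plus_pattern u P \<longleftrightarrow>
     (let r = card (set u); m = length u - 1 in
       zero_one r m P \<and> one_double_column r m P \<and> isomorphic u (rows_down r m P))"

definition u_minus_pattern :: "'a list \<Rightarrow> matrix \<Rightarrow> bool" where
  "u_minus_pattern u P \<longleftrightarrow>
     (let r = card (set u); m = length u - 1 in
       zero_one r m P \<and> one_double_column r m P \<and> isomorphic u (rows_up r m P))"

(* Index sets of the copies of the r x m matrix P in the n x N all-ones matrix. *)
definition copies :: "nat \<Rightarrow> nat \<Rightarrow> nat \<Rightarrow> nat \<Rightarrow> matrix \<Rightarrow> (nat \<times> nat) set set" where
  "copies n N r m P =
     {{(row p, col q) | p q. p \<in> {1..r} \<and> q \<in> {1..m} \<and> P p q = 1} | row col.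
        strict_mono_on {1..r} row \<and> row ` {1..r} \<subseteq> {1..n} \<and>
        strict_mono_on {1..m} col \<and> col ` {1..m} \<subseteq> {1..N}}"

definition Pats :: "nat \<Rightarrow> nat \<Rightarrow> 'a list \<Rightarrow> (nat \<times> nat) set set" where
  "Pats n N u = (\<Union>P\<in>{P. u_pattern u P}. copies n N (card (set u)) (length u) P)"

definition Pats_plus :: "nat \<Rightarrow> nat \<Rightarrow> 'a list \<Rightarrow> (nat \<times> nat) set set" where
  "Pats_plus n N u =
     (\<Union>P\<in>{P. u_plus_pattern u P}. copies n N (card (set u)) (length u - 1) P)"

definition Pats_minus :: "nat \<Rightarrow> nat \<Rightarrow> 'a list \<Rightarrow> (nat \<times> nat) set set" where
  "Pats_minus n N u =
     (\<Union>P\<in>{P. u_minus_pattern u P}. copies n N (card (set u)) (length u - 1) P)"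

definition Pats_all :: "nat \<Rightarrow> nat \<Rightarrow> 'a list \<Rightarrow> (nat \<times> nat) set set" where
  "Pats_all n N u = Pats n N u \<union> Pats_plus n N u \<union> Pats_minus n N u"

definition A_at :: "nat \<Rightarrow> nat \<Rightarrow> 'a list \<Rightarrow> nat \<Rightarrow> nat \<Rightarrow> (nat \<times> nat) set set" where
  "A_at n N u i j = {P' \<in> Pats n N u. (i, j) \<in> P'}"

definition A_plus :: "nat \<Rightarrow> nat \<Rightarrow> 'a list \<Rightarrow> nat \<Rightarrow> nat \<Rightarrow> (nat \<times> nat) set set" where
  "A_plus n N u i j = {P' \<in> Pats_plus n N u. (i, j) \<in> P'}"

definition A_minus :: "nat \<Rightarrow> nat \<Rightarrow> 'a list \<Rightarrow> nat \<Rightarrow> nat \<Rightarrow> (nat \<times> nat) set set" where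
  "A_minus n N u i j = {P' \<in> Pats_minus n N u. (i, j) \<in> P'}"


(* x extended by 0 to all integer column indices *)
definition xz :: "nat \<Rightarrow> (nat \<Rightarrow> nat \<Rightarrow> int) \<Rightarrow> nat \<Rightarrow> int \<Rightarrow> int" where
  "xz N x i t = (if 1 \<le> t \<and> t \<le> int N then x i (nat t) else 0)"

definition f_val :: "(nat \<Rightarrow> nat \<Rightarrow> int) \<Rightarrow> (nat \<times> nat) set \<Rightarrow> int" where
  "f_val x P' = (\<Sum>(i, j)\<in>P'. x i j)"

definition feasible ::
  "nat \<Rightarrow> nat \<Rightarrow> 'a list \<Rightarrow> (nat \<Rightarrow> nat \<Rightarrow> int) \<Rightarrow> ((nat \<times> nat) set \<Rightarrow> int) \<Rightarrow> bool" where
  "feasible n N u x y \<longleftrightarrow>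
     (let l = int (length u); r = int (card (set u)) in
      (\<forall>i\<in>{1..n}. \<forall>j\<in>{1..N}. x i j \<in> {0, 1}) \<and>
      (\<forall>P'\<in>Pats_all n N u. y P' \<in> {0, 1}) \<and>
      (\<forall>P'\<in>Pats n N u. f_val x P' < l) \<and>
      (\<forall>P'\<in>Pats_all n N u. (l - 1) * y P' - f_val x P' \<le> 0) \<and>
      (\<forall>P'\<in>Pats_all n N u. y P' - f_val x P' \<ge> - l + 2) \<and>
      (\<forall>i\<in>{1..n}. \<forall>j\<in>{1..N}.
         (\<Sum>P'\<in>A_at n N u i j \<union> A_plus n N u i j. y P') - (\<Sum>t=i+1..n. x t j)
           + (\<Sum>t=int j - r + 1..int j + r - 2. xz N x i t) \<ge> 0) \<and>
      (\<forall>i\<in>{1..n}. \<forall>j\<in>{1..N}.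
         (\<Sum>P'\<in>A_at n N u i j \<union> A_plus n N u i j. y P') - (\<Sum>t=1..i-1. x t j)
           + (\<Sum>t=int j - r + 2..int j + r - 1. xz N x i t) \<ge> 0) \<and>
      (\<forall>i\<in>{1..n}. \<forall>j\<in>{1..N}.
         (\<Sum>P'\<in>A_at n N u i j \<union> A_minus n N u i j. y P') - (\<Sum>t=i+1..n. x t j)
           + (\<Sum>t=int j - r + 2..int j + r - 1. xz N x i t) \<ge> 0) \<and>
      (\<forall>i\<in>{1..n}. \<forall>j\<in>{1..N}.
         (\<Sum>P'\<in>A_at n N u i j \<union> A_minus n N u i j. y P') - (\<Sum>t=1..i-1. x t j)
           + (\<Sum>t=int j - r + 1..int j + r - 2. xz N x i t) \<ge> 0) \<and>
      (\<forall>j\<in>{1..N}. (\<Sum>i=1..n. x i j) \<le> 1) \<and>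
      (\<forall>j\<in>{1..N - 1}. (\<Sum>i=1..n. x i j) \<ge> (\<Sum>i=1..n. x i (j + 1))) \<and>
      (\<forall>i\<in>{1..n}. \<forall>j\<in>{1..N + 1 - card (set u)}.
         (\<Sum>t=int j..int j + r - 1. xz N x i t) \<le> 1) \<and>
      (\<forall>i\<in>{1..card (set u) - 1}. x i i = 1))"

definition objective :: "nat \<Rightarrow> nat \<Rightarrow> (nat \<Rightarrow> nat \<Rightarrow> int) \<Rightarrow> int" where
  "objective n N x = (\<Sum>i=1..n. \<Sum>j=1..N. x i j)"

definition is_minimum :: "int set \<Rightarrow> int \<Rightarrow> bool" where
  "is_minimum S m \<longleftrightarrow> m \<in> S \<and> (\<forall>v\<in>S. m \<le> v)"

end

theory Submission
  imports Defs
begin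

text \<open>
  Write \<open>r\<close> for the number of letters of \<open>u\<close> and \<open>\<ell>\<close> for its length.  A feasible assignment \<open>x\<close>
  has at most one 1 in each column, and its nonzero columns come first.  So \<open>x\<close> spells a word \<open>s\<close> over
  \<open>{1..n}\<close> of length at most \<open>N\<close>, whose length is the objective value
  (\<open>structural_constraints_encodes\<close>, \<open>objective_encodes\<close>).  The core of the proof is that, for \<open>x\<close> spelling a
  nonempty word \<open>s\<close>, feasibility means that \<open>s\<close> is saturated, starts with \<open>1, \<dots>, r - 1\<close>, and that
  each selector \<open>y S\<close> is the indicator of \<open>f(S) \<ge> \<ell> - 1\<close> (\<open>feasible_iff_saturated\<close>).

  The sets \<open>S\<close> in the program are the sets of cells that, read column by column, spell a copy of
  \<open>u\<close> (\<open>copies_patterns\<close>).  Since the cells of \<open>s\<close> are in reading order too, containment of sets amounts to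
  being a subsequence (\<open>subseq_of_sorted_before\<close>).  Thus \<open>f(S) < \<ell>\<close> for all ordinary \<open>S\<close> says that
  \<open>s\<close> avoids \<open>u\<close>.  To insert a letter \<open>i\<close> next to the letter \<open>t\<close> in column \<open>j\<close>, put an extra cell \<open>(i, j)\<close> into that
  column; if \<open>i \<noteq> t\<close>, it stands on the desired side of \<open>t\<close> when the column is read in one of the two
  directions, downwards or upwards.  A copy of \<open>u\<close> created by the insertion then is a set \<open>S\<close> through
  \<open>(i, j)\<close> whose other \<open>\<ell> - 1\<close> cells belong to \<open>s\<close>; it has \<open>j\<close> as a double column or no double column,
  according to whether it uses \<open>t\<close> (\<open>contains_copy_insert_iff\<close>).  The window sum detects a loss of
  sparsity (\<open>insertion_window_pos_iff\<close>).  So each insertion constraint says that a certain insertion is blocked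
  (\<open>insertion_slack_nonneg_iff\<close>), and together they cover all insertions.

  Consequently feasible values are lengths of saturated words and are at least \<open>Sat n u\<close>.  The value
  \<open>Sat n u\<close> is attained: saturated words exist because sparse words avoiding \<open>u\<close> have bounded length
  (\<open>sparse_avoiding_bounded\<close>), a shortest one fits into \<open>N\<close> columns, and renaming its letters gives it the
  required beginning (\<open>saturated_normalise\<close>).  Finally, a saturated word has length at least
  \<open>\<ell> - 1\<close> (\<open>saturated_length\<close>), so \<open>N \<ge> \<ell>\<close>, which leaves room for a copy through every cell
  (\<open>copy_set_through_cell\<close>).
\<close>

section \<open>Sparsity and insertion of a letter\<close>

lemma sparse_iff_nth:
  "sparse r s \<longleftrightarrow> (\<forall>p q. p < q \<longrightarrow> q < length s \<longrightarrow> q < p + r \<longrightarrow> s ! p \<noteq> s ! q)"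
proof
  assume sp: "sparse r s"
  show "\<forall>p q. p < q \<longrightarrow> q < length s \<longrightarrow> q < p + r \<longrightarrow> s ! p \<noteq> s ! q"
  proof (intro allI impI)
    fix p q assume pq: "p < q" "q < length s" "q < p + r"
    have d: "distinct (take r (drop p s))" using sp by (simp add: sparse_def)
    have "take r (drop p s) ! 0 \<noteq> take r (drop p s) ! (q - p)"
      using pq by (subst nth_eq_iff_index_eq[OF d]) auto
    then show "s ! p \<noteq> s ! q" using pq by simp
  qed
next
  assume "\<forall>p q. p < q \<longrightarrow> q < length s \<longrightarrow> q < p + r \<longrightarrow> s ! p \<noteq> s ! q"
  then have D: "s ! p \<noteq> s ! q" if "p < q" "q < length s" "q < p + r" for p q
    using that by blast
  have E: "s ! (i + p) \<noteq> s ! (i + q)" if "p \<noteq> q" "i + p < length s" "i + q < length s" "p < r" "q < r" for i p q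
    using that D[of "i + p" "i + q"] D[of "i + q" "i + p"] by (cases "p < q") auto
  then have "distinct (take r (drop i s))" for i
    unfolding distinct_conv_nth by (auto simp: less_diff_conv add.commute)
  then show "sparse r s" by (simp add: sparse_def)
qed

lemma length_insert_at [simp]: "length (insert_at k a s) = Suc (length s)"
  by (simp add: insert_at_def)

lemma nth_insert_at:
  assumes "k \<le> length s"
  shows "insert_at k a s ! p = (if p < k then s ! p else if p = k then a else s ! (p - 1))"
  using assms by (auto simp: insert_at_def nth_append nth_Cons' min_def)

lemma map_insert_at: "map f (insert_at k a s) = insert_at k (f a) (map f s)"
  by (simp add: insert_at_def take_map drop_map)

lemma set_insert_at: "set (insert_at k a s) = insert a (set s)"
  by (metis append_take_drop_id insert_at_def list.simps(15) set_append Un_insert_right)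

text \<open>
  An insertion only moves old letters further apart, so in a sparse sequence the single danger is an
  old occurrence of the new letter among the \<open>r - 1\<close> letters on either side of the gap.  With \<open>k\<close> letters
  before the gap, these are the positions \<open>p\<close> (from 0) with \<open>k < p + r\<close> and \<open>p + 1 < k + r\<close>.
\<close>

lemma sparse_insert_at_iff:
  assumes sp: "sparse r s" and k: "k \<le> length s" and r: "r \<ge> 1"
  shows "sparse r (insert_at k a s) \<longleftrightarrow>
    (\<forall>p < length s. k < p + r \<longrightarrow> p + 1 < k + r \<longrightarrow> s ! p \<noteq> a)"
proof
  assume L: "sparse r (insert_at k a s)"
  show "\<forall>p < length s. k < p + r \<longrightarrow> p + 1 < k + r \<longrightarrow> s ! p \<noteq> a"
  proof (intro allI impI)
    fix p assume p: "p < length s" "k < p + r" "p + 1 < k + r"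
    show "s ! p \<noteq> a"
    proof (cases "p < k")
      case True
      then have "insert_at k a s ! p \<noteq> insert_at k a s ! k"
        using L p k unfolding sparse_iff_nth by simp
      then show ?thesis using True k by (simp add: nth_insert_at)
    next
      case False
      then have "k < Suc p" "Suc p < length (insert_at k a s)" "Suc p < k + r"
        using p by simp_all
      then have "insert_at k a s ! k \<noteq> insert_at k a s ! (Suc p)"
        using L unfolding sparse_iff_nth by blast
      then show ?thesis using False k by (simp add: nth_insert_at)
    qed
  qed
next
  assume R: "\<forall>p < length s. k < p + r \<longrightarrow> p + 1 < k + r \<longrightarrow> s ! p \<noteq> a"
  have D: "\<And>p q. p < q \<Longrightarrow> q < length s \<Longrightarrow> q < p + r \<Longrightarrow> s ! p \<noteq> s ! q"
    using sp unfolding sparse_iff_nth by blast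
  show "sparse r (insert_at k a s)"
    unfolding sparse_iff_nth
  proof (intro allI impI)
    fix p q assume pq: "p < q" "q < length (insert_at k a s)" "q < p + r"
    consider "q < k" | "q = k" | "p < k" "k < q" | "p = k" | "k < p" using pq by linarith
    then show "insert_at k a s ! p \<noteq> insert_at k a s ! q"
    proof cases
      case 1 then show ?thesis using pq D[of p q] k by (simp add: nth_insert_at)
    next
      case 2 then show ?thesis using pq R[rule_format, of p] k r by (simp add: nth_insert_at)
    next
      case 3 then show ?thesis using pq D[of p "q - 1"] k by (simp add: nth_insert_at)
    next
      case 4
      then have "s ! (q - 1) \<noteq> a" using pq r by (intro R[rule_format]) auto
      then show ?thesis using 4 pq k by (auto simp: nth_insert_at)
    next
      case 5 then show ?thesis using pq D[of "p - 1" "q - 1"] k by (simp add: nth_insert_at)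
    qed
  qed
qed

section \<open>Renaming letters\<close>

lemma isomorphic_map_left:
  assumes "inj_on g (set t)" "isomorphic u t"
  shows "isomorphic u (map g t)"
proof -
  obtain f where "inj_on f (set u)" "t = map f u" using assms(2) by (auto simp: isomorphic_def)
  moreover from this have "inj_on (g \<circ> f) (set u)" using assms(1) by (intro comp_inj_on) simp_all
  ultimately show ?thesis unfolding isomorphic_def by (intro exI[of _ "g \<circ> f"]) simp
qed

lemma isomorphic_map_iff:
  assumes "inj_on g (set t)"
  shows "isomorphic u (map g t) \<longleftrightarrow> isomorphic u t"
proof
  assume "isomorphic u (map g t)"
  moreover have "map (inv_into (set t) g) (map g t) = t"
    using assms by (auto intro: map_idI)
  moreover have "inj_on (inv_into (set t) g) (set (map g t))"
    by (simp add: inj_on_inv_into)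
  ultimately show "isomorphic u t" by (metis isomorphic_map_left)
qed (use assms in \<open>rule isomorphic_map_left\<close>)

lemma isomorphic_length: "isomorphic u t \<Longrightarrow> length t = length u"
  by (auto simp: isomorphic_def)

lemma isomorphic_card: "isomorphic u t \<Longrightarrow> card (set t) = card (set u)"
  by (auto simp: isomorphic_def card_image)

lemma contains_copy_map_iff:
  assumes "inj_on g (set s)"
  shows "contains_copy (map g s) u \<longleftrightarrow> contains_copy s u"
proof
  assume "contains_copy (map g s) u"
  then obtain t where t: "subseq t (map g s)" "isomorphic u t" by (auto simp: contains_copy_def)
  then obtain t' where t': "subseq t' s" "t = map g t'" 
    unfolding subseq_conv_nths by (auto simp: nths_map)
  moreover have "set t' \<subseteq> set s" using t'(1) by (auto dest: list_emb_set)
  ultimately show "contains_copy s u" using t assms unfolding contains_copy_def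
    by (metis inj_on_subset isomorphic_map_iff)
next
  assume "contains_copy s u"
  then obtain t where t: "subseq t s" "isomorphic u t" by (auto simp: contains_copy_def)
  moreover have "set t \<subseteq> set s" using t(1) by (auto dest: list_emb_set)
  ultimately show "contains_copy (map g s) u" using assms unfolding contains_copy_def
    by (metis inj_on_subset isomorphic_map_iff subseq_map)
qed

lemma contains_copy_length: "contains_copy s u \<Longrightarrow> length u \<le> length s"
  unfolding contains_copy_def using isomorphic_length list_emb_length by metis

lemma sparse_map_iff:
  assumes "inj_on g (set s)"
  shows "sparse r (map g s) \<longleftrightarrow> sparse r s"
proof -
  have "inj_on g (set (take r (drop i s)))" for i
    using assms by (rule inj_on_subset) (meson set_drop_subset set_take_subset subset_trans)
  then show ?thesis by (simp add: sparse_def drop_map take_map distinct_map)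
qed

lemma saturated_map:
  assumes g: "bij_betw g A A" and sat: "saturated A u s"
  shows "saturated A u (map g s)"
proof -
  have inj: "inj_on g X" if "X \<subseteq> A" for X using that g by (meson bij_betw_def inj_on_subset)
  have sA: "set s \<subseteq> A" using sat by (simp add: saturated_def)
  have ins: "\<not> sparse (card (set u)) (insert_at k a (map g s)) \<or> contains_copy (insert_at k a (map g s)) u"
    if a: "a \<in> A" and k: "k \<le> length s" for a k
  proof -
    obtain b where b: "b \<in> A" "a = g b" using a g by (metis bij_betw_iff_bijections)
    have i: "inj_on g (set (insert_at k b s))" using b sA by (intro inj) (simp add: set_insert_at)
    show ?thesis
      using sat b(1) k unfolding b(2) map_insert_at[symmetric] sparse_map_iff[OF i] contains_copy_map_iff[OF i]
      by (auto simp: saturated_def)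
  qed
  show ?thesis
    unfolding saturated_def
  proof (intro conjI ballI allI impI)
    show "set (map g s) \<subseteq> A" using sA g by (auto simp: bij_betw_def)
    show "sparse (card (set u)) (map g s)" "avoids (map g s) u"
      using sat sA by (auto simp: sparse_map_iff contains_copy_map_iff inj saturated_def)
  qed (use ins in auto)
qed

section \<open>Existence and length of saturated sequences\<close>

text \<open>
  Each occurrence of the block \<open>w\<close> supplies one letter of \<open>t\<close>, in the order in which they are needed.
\<close>

lemma subseq_concat_blocks:
  assumes "set t \<subseteq> set w" "length t \<le> count_list bs w"
  shows "subseq t (concat bs)"
  using assms
proof (induction bs arbitrary: t)
  case (Cons b bs)
  show ?case
  proof (cases "b = w \<and> t \<noteq> []")
    case True
    then obtain x t' where t: "t = x # t'" by (cases t) auto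
    have "subseq [x] b" using t True Cons.prems by (simp add: subseq_singleton_left)
    moreover have "subseq t' (concat bs)" using Cons t True by auto
    ultimately have "subseq ([x] @ t') (b @ concat bs)" by (rule list_emb_append_mono)
    then show ?thesis by (simp add: t)
  next
    case False
    then have "subseq t (concat bs)" using Cons by (cases "t = []") auto
    then show ?thesis by (simp add: list_emb_append2)
  qed
qed auto

lemma concat_blocks: "concat (map (\<lambda>q. take r (drop (r * q) s)) [0..<M]) = take (r * M) s"
  by (induction M) (simp_all add: take_add mult_Suc_right add.commute[of r])

text \<open>
  Pigeonhole: cut the sequence into consecutive blocks of length \<open>r\<close>.  If it is long enough, one word \<open>w\<close>
  occurs as a block \<open>length u\<close> times.  Sparsity makes the \<open>r\<close> letters of \<open>w\<close> distinct, so the letters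
  of \<open>u\<close> can be renamed into those of \<open>w\<close>, and every word of length \<open>length u\<close> in these letters is a subsequence of
  the repeated blocks.
\<close>

lemma sparse_avoiding_bounded:
  assumes A: "finite A" and s: "set s \<subseteq> A" and sp: "sparse (card (set u)) s" and av: "avoids s u"
  shows "length s < card (set u) * Suc (length u * card {w. set w \<subseteq> A \<and> length w = card (set u)})"
proof (rule ccontr)
  define r W where "r = card (set u)" and "W = {w. set w \<subseteq> A \<and> length w = r}"
  define M where "M = Suc (length u * card W)"
  define bs where "bs = map (\<lambda>q. take r (drop (r * q) s)) [0..<M]"
  assume "\<not> ?thesis"
  then have len: "r * M \<le> length s" by (simp add: r_def W_def M_def)
  have W: "finite W" unfolding W_def using A by (rule finite_lists_length_eq)
  have bsW: "set bs \<subseteq> W"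
  proof -
    have "set (take r (drop (r * q) s)) \<subseteq> A" for q
      using s by (meson set_drop_subset set_take_subset subset_trans)
    moreover have "r \<le> length s - r * q" if "q < M" for q
    proof -
      have "r * Suc q \<le> r * M" using that by (intro mult_le_mono2) simp
      then show ?thesis using len by simp
    qed
    ultimately show ?thesis by (auto simp: bs_def W_def)
  qed
  have "\<exists>w\<in>W. length u \<le> count_list bs w"
  proof (rule ccontr)
    assume "\<not> ?thesis"
    then have "(\<Sum>w\<in>W. count_list bs w) \<le> card W * length u"
      by (intro sum_bounded_above[where K = "length u", simplified]) (simp add: not_le less_imp_le)
    moreover have "(\<Sum>w\<in>W. count_list bs w) = M"
      using sum_count_set[OF bsW W] by (simp add: bs_def)
    ultimately show False by (simp add: M_def mult.commute)
  qed
  then obtain w where w: "w \<in> W" "length u \<le> count_list bs w" by blast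
  show False
  proof (cases "u = []")
    case True
    then show False using av by (auto simp: contains_copy_def isomorphic_def)
  next
    case False
    then have "count_list bs w \<noteq> 0" using w(2) by (cases u) auto
    then have "w \<in> set bs" by (metis count_list_0_iff)
    then have "distinct w" using sp by (auto simp: bs_def sparse_def r_def)
    then have "card (set w) = card (set u)" using w(1) by (simp add: W_def r_def distinct_card)
    then obtain f where f: "bij_betw f (set u) (set w)"
      by (metis List.finite_set finite_same_card_bij)
    have "subseq (map f u) (concat bs)"
      using f w(2) by (intro subseq_concat_blocks[of _ w]) (auto simp: bij_betw_def)
    moreover have "subseq (concat bs) s"
      unfolding bs_def concat_blocks by (meson prefix_imp_subseq take_is_prefix)
    ultimately have "contains_copy s u"
      using f unfolding contains_copy_def isomorphic_def bij_betw_def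
      by (metis subseq_order.trans)
    then show False using av by simp
  qed
qed

text \<open>
  A longest sparse sequence avoiding \<open>u\<close> is saturated: an admissible insertion would make it longer.
\<close>

lemma saturated_exists:
  assumes A: "finite A" and u: "u \<noteq> []"
  shows "\<exists>s. saturated A u s"
proof -
  define Q where "Q s \<longleftrightarrow> set s \<subseteq> A \<and> sparse (card (set u)) s \<and> avoids s u" for s
  have "Q []" using u by (auto simp: Q_def sparse_def contains_copy_def isomorphic_def)
  moreover have "\<exists>B. \<forall>s. Q s \<longrightarrow> length s < B"
    using sparse_avoiding_bounded[OF A] unfolding Q_def by blast
  ultimately obtain s where s: "Q s" "\<And>t. Q t \<Longrightarrow> length t \<le> length s"
    by (metis ex_has_greatest_nat[of Q "[]" length])
  have "saturated A u s"
    unfolding saturated_def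
  proof (intro conjI ballI allI impI)
    fix a k assume a: "a \<in> A" and k: "k \<le> length s"
    show "\<not> sparse (card (set u)) (insert_at k a s) \<or> contains_copy (insert_at k a s) u"
      using s(2)[of "insert_at k a s"] a s(1) by (auto simp: Q_def set_insert_at)
  qed (use s(1) in \<open>auto simp: Q_def\<close>)
  then show ?thesis ..
qed

text \<open>
  The last \<open>r - 1\<close> letters leave some letter of the alphabet free.  Appending it keeps the sequence
  sparse, so saturation forces a copy of \<open>u\<close> in a sequence only one letter longer.
\<close>

lemma saturated_length:
  assumes sat: "saturated A u s" and r: "card (set u) \<ge> 1" and A: "finite A" "card (set u) \<le> card A"
  shows "length u \<le> Suc (length s)"
proof -
  define r where "r = card (set u)"
  have sp: "sparse r s" using sat by (simp add: saturated_def r_def)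
  have "card (set (drop (length s - (r - 1)) s)) \<le> r - 1"
    by (rule order_trans[OF card_length]) simp
  then have "\<not> A \<subseteq> set (drop (length s - (r - 1)) s)"
    using A r card_mono[of "set (drop (length s - (r - 1)) s)" A] by (auto simp: r_def)
  then obtain a where a: "a \<in> A" "a \<notin> set (drop (length s - (r - 1)) s)" by blast
  have "s ! p \<noteq> a" if "p < length s" "length s < p + r" for p
  proof -
    have "drop (length s - (r - 1)) s ! (p - (length s - (r - 1))) = s ! p"
      using that by simp
    moreover have "p - (length s - (r - 1)) < length (drop (length s - (r - 1)) s)"
      using that by simp
    ultimately show ?thesis using a(2) nth_mem by metis
  qed
  then have "sparse r (insert_at (length s) a s)"
    using sparse_insert_at_iff[OF sp, of "length s" a] r by (auto simp: r_def)
  then have "contains_copy (insert_at (length s) a s) u"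
    using sat a(1) by (auto simp: saturated_def r_def)
  then show ?thesis using contains_copy_length by fastforce
qed

lemma saturated_Sat:
  assumes "u \<noteq> []"
  shows "\<exists>s :: nat list. saturated {1..n} u s \<and> length s = Sat n u"
proof -
  obtain s :: "nat list" where "saturated {1..n} u s" using saturated_exists[of "{1..n}" u] assms by auto
  then have "\<exists>k. \<exists>s :: nat list. saturated {1..n} u s \<and> length s = k" by blast
  then show ?thesis unfolding Sat_def by (rule LeastI_ex)
qed

lemma Sat_le: "saturated {1..n} u s \<Longrightarrow> Sat n u \<le> length s"
  unfolding Sat_def by (rule Least_le) blast

text \<open>
  The first \<open>r - 1\<close> letters are distinct by sparsity, so a permutation of the alphabet carries them to
  \<open>1, \<dots>, r - 1\<close>.  This is why fixing the corresponding variables of the program costs nothing.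
\<close>

lemma saturated_normalise:
  assumes sat: "saturated {1..n} u s" and r: "card (set u) \<ge> 1" and n: "card (set u) \<le> n"
  shows "\<exists>s'. saturated {1..n} u s' \<and> length s' = length s \<and> (\<forall>p < card (set u) - 1. s' ! p = Suc p)"
proof -
  define m where "m = card (set u) - 1"
  define X where "X = set (take m s)"
  have "length u \<le> Suc (length s)" using saturated_length[OF sat] assms by simp
  then have m: "m \<le> length s" using card_length[of u] by (simp add: m_def)
  have "distinct (take (card (set u)) (drop 0 s))"
    using sat unfolding saturated_def sparse_def by blast
  then have d: "distinct (take m s)" using distinct_take[of _ m]
    by (metis drop0 m_def diff_le_self min_def take_take)
  have XA: "X \<subseteq> {1..n}" using sat set_take_subset[of m s] by (auto simp: X_def saturated_def)
  have cX: "card X = m" using d m by (simp add: X_def distinct_card)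
  \<comment> \<open>\<open>h\<close> sends a letter of the initial part to its position, counted from 1.\<close>
  define h where "h a = Suc (inv_into {..<m} ((!) (take m s)) a)" for a
  have bt: "bij_betw ((!) (take m s)) {..<m} X"
    unfolding X_def using d m by (intro bij_betw_nth) auto
  have h: "bij_betw h X {1..m}"
    using bij_betw_trans[OF bij_betw_inv_into[OF bt], of Suc "{1..m}"]
    by (simp add: bij_betw_def image_Suc_lessThan h_def[abs_def] comp_def)
  have "card ({1..n} - X) = card ({1..n} - {1..m})"
    using XA cX n by (subst (1 2) card_Diff_subset) (auto simp: m_def finite_subset)
  then obtain h' where h': "bij_betw h' ({1..n} - X) ({1..n} - {1..m})"
    by (metis finite_Diff finite_atLeastAtMost finite_same_card_bij)
  define g where "g a = (if a \<in> X then h a else h' a)" for a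
  have "bij_betw g (X \<union> ({1..n} - X)) ({1..m} \<union> ({1..n} - {1..m}))"
    using h h' unfolding g_def by (rule bij_betw_disjoint_Un) auto
  moreover have "X \<union> ({1..n} - X) = {1..n}" "{1..m} \<union> ({1..n} - {1..m}) = {1..n}"
    using XA n by (auto simp: m_def)
  ultimately have "bij_betw g {1..n} {1..n}" by simp
  then have "saturated {1..n} u (map g s)" using sat by (rule saturated_map)
  moreover have "map g s ! p = Suc p" if "p < m" for p
  proof -
    have "inv_into {..<m} ((!) (take m s)) (take m s ! p) = p"
      using bt that by (intro inv_into_f_f) (auto simp: bij_betw_def)
    moreover have "take m s ! p \<in> X" using bt that by (auto simp: bij_betw_def)
    ultimately show ?thesis using that m by (simp add: g_def h_def)
  qed
  ultimately show ?thesis unfolding m_def by (intro exI[of _ "map g s"]) simp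
qed

section \<open>Copies of patterns as sorted lists of cells\<close>

text \<open>
  The column conditions on patterns prescribe how many ones each column has.  The next lemmas replace
  them by two facts that are easier to transport: no column is empty, and the total number of ones.
\<close>

lemma sum_eq_excess_plus_card:
  fixes f :: "'a \<Rightarrow> nat"
  assumes "\<forall>a\<in>A. f a \<noteq> 0"
  shows "sum f A = (\<Sum>a\<in>A. f a - 1) + card A"
proof -
  have "sum f A = (\<Sum>a\<in>A. (f a - 1) + 1)" using assms by (intro sum.cong) auto
  also have "\<dots> = (\<Sum>a\<in>A. f a - 1) + card A" by (subst sum.distrib) simp
  finally show ?thesis .
qed

lemma all_one_iff_sum:
  fixes f :: "'a \<Rightarrow> nat"
  assumes "finite A"
  shows "(\<forall>a\<in>A. f a = 1) \<longleftrightarrow> (\<forall>a\<in>A. f a \<noteq> 0) \<and> sum f A = card A"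
proof -
  have "f a = 1 \<longleftrightarrow> f a \<noteq> 0 \<and> f a - 1 = 0" for a by auto
  then show ?thesis using assms sum_eq_excess_plus_card[of A f] by auto
qed

lemma one_two_iff_sum:
  fixes f :: "'a \<Rightarrow> nat"
  assumes "finite A"
  shows "(\<exists>c\<in>A. f c = 2 \<and> (\<forall>a\<in>A - {c}. f a = 1)) \<longleftrightarrow> (\<forall>a\<in>A. f a \<noteq> 0) \<and> sum f A = Suc (card A)"
    (is "?L \<longleftrightarrow> ?R")
proof -
  have eq: "sum f A = Suc (card A) \<longleftrightarrow> (\<Sum>a\<in>A. f a - 1) = 1" if "\<forall>a\<in>A. f a \<noteq> 0"
    using sum_eq_excess_plus_card[OF that] by simp
  show ?thesis
  proof
    assume L: ?L
    then obtain c where c: "c \<in> A" "f c = 2" "\<forall>a\<in>A - {c}. f a = 1" by blast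
    then have nz: "\<forall>a\<in>A. f a \<noteq> 0" by (metis Diff_iff empty_iff insert_iff zero_neq_numeral zero_neq_one)
    moreover have "(\<Sum>a\<in>A. f a - 1) = 1"
      using c assms by (subst sum_eq_1_iff) (auto intro!: bexI[of _ c])
    ultimately show ?R using eq by blast
  next
    assume R: ?R
    then have "(\<Sum>a\<in>A. f a - 1) = 1" using eq by blast
    then obtain c where c: "c \<in> A" "f c - 1 = 1" "\<forall>b\<in>A. c \<noteq> b \<longrightarrow> f b - 1 = 0"
      using assms by (subst (asm) sum_eq_1_iff) auto
    have "f c = 2" using c(2) by simp
    moreover have "f a = 1" if "a \<in> A - {c}" for a
    proof -
      have "f a - 1 = 0" "f a \<noteq> 0" using that c R by auto
      then show ?thesis by simp
    qed
    ultimately show ?L using c(1) by blast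
  qed
qed

lemma strict_mono_enumeration:
  fixes A :: "nat set"
  assumes "finite A"
  obtains e where "strict_mono_on {1..card A} e" "e ` {1..card A} = A"
proof
  define xs where "xs = sorted_list_of_set A"
  have len: "length xs = card A" and set: "set xs = A" and sorted: "sorted_wrt (<) xs"
    using assms by (simp_all add: xs_def)
  show "strict_mono_on {1..card A} (\<lambda>p. xs ! (p - 1))"
    using sorted len by (intro strict_mono_onI) (auto simp: sorted_wrt_iff_nth_less)
  have "(\<lambda>p. xs ! (p - 1)) ` {1..card A} = (!) xs ` {..<card A}"
    by (force simp: image_def intro: bexI[of _ "Suc _"])
  then show "(\<lambda>p. xs ! (p - 1)) ` {1..card A} = A"
    using len set by (auto simp: set_conv_nth)
qed

text \<open>
  The patterns with a double column come in two kinds, which differ only in whether a column is read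
  from top to bottom or from bottom to top.  The locale treats both at once: \<open>lt\<close> is the order in
  which the rows of a column are read, and \<open>listing\<close> arranges a set of rows in that order.
\<close>

locale column_reading =
  fixes lt :: "nat \<Rightarrow> nat \<Rightarrow> bool" and listing :: "nat set \<Rightarrow> nat list"
  assumes lt: "lt = (<) \<or> lt = (>)"
    and listing_set: "finite S \<Longrightarrow> set (listing S) = S"
    and listing_sorted: "finite S \<Longrightarrow> sorted_wrt lt (listing S)"
begin

lemma lt_mono: "strict_mono_on A f \<Longrightarrow> a \<in> A \<Longrightarrow> b \<in> A \<Longrightarrow> lt a b \<Longrightarrow> lt (f a) (f b)"
  using lt by (auto dest: strict_mono_onD)

definition before :: "nat \<times> nat \<Rightarrow> nat \<times> nat \<Rightarrow> bool" where
  "before a b \<longleftrightarrow> snd a < snd b \<or> snd a = snd b \<and> lt (fst a) (fst b)"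

lemma before_irrefl: "\<not> before a a"
  using lt by (auto simp: before_def)

lemma before_trans: "before a b \<Longrightarrow> before b c \<Longrightarrow> before a c"
  using lt unfolding before_def by auto

lemma sorted_before_distinct: "sorted_wrt before zs \<Longrightarrow> distinct zs"
  by (induction zs) (use before_irrefl in auto)

lemma sorted_before_unique:
  "sorted_wrt before xs \<Longrightarrow> sorted_wrt before ys \<Longrightarrow> set xs = set ys \<Longrightarrow> xs = ys"
proof (induction xs arbitrary: ys)
  case (Cons x xs)
  then obtain y ys' where ys: "ys = y # ys'" by (cases ys) auto
  have xy: "x = y"
  proof (rule ccontr)
    assume "x \<noteq> y"
    moreover have "x \<in> set ys" "y \<in> set (x # xs)" using Cons.prems(3) ys by auto
    ultimately have "before y x" "before x y" using Cons.prems(1,2) ys by auto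
    then show False using before_trans before_irrefl by blast
  qed
  moreover have "x \<notin> set xs" "y \<notin> set ys'"
    using sorted_before_distinct[OF Cons.prems(1)] sorted_before_distinct[OF Cons.prems(2)] ys by auto
  ultimately have "set xs = set ys'" using Cons.prems(3) ys by (simp add: insert_ident)
  then show ?case using Cons ys xy by simp
qed simp

text \<open>
  In sorted lists of cells, being a subsequence is a matter of the underlying sets.  This is what
  allows the program to speak about sets of cells instead of subsequences.
\<close>

lemma subseq_of_sorted_before:
  assumes "sorted_wrt before zs" "sorted_wrt before W" "set zs \<subseteq> set W"
  shows "subseq zs W"
proof -
  have "zs = filter (\<lambda>z. z \<in> set zs) W"
    using assms by (intro sorted_before_unique sorted_wrt_filter) auto
  then show ?thesis by (metis subseq_filter_left)
qed

definition reading :: "nat \<Rightarrow> nat \<Rightarrow> matrix \<Rightarrow> nat list" where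
  "reading r m P = concat (map (\<lambda>q. listing (col_ones r P q)) [1..<m+1])"

text \<open>
  The ones of \<open>P\<close>, moved to the chosen rows and columns, in the order in which \<open>reading\<close> visits them.
\<close>

definition placed :: "(nat \<Rightarrow> nat) \<Rightarrow> (nat \<Rightarrow> nat) \<Rightarrow> nat \<Rightarrow> nat \<Rightarrow> matrix \<Rightarrow> (nat \<times> nat) list" where
  "placed row col r m P =
     concat (map (\<lambda>q. map (\<lambda>p. (row p, col q)) (listing (col_ones r P q))) [1..<m+1])"

lemma finite_col_ones [simp]: "finite (col_ones r P q)"
  by (simp add: col_ones_def)

lemma listing_distinct:
  assumes "finite S" shows "distinct (listing S)"
proof -
  have "sorted_wrt lt xs \<Longrightarrow> distinct xs" for xs
    using lt by (induction xs) auto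
  then show ?thesis using listing_sorted[OF assms] .
qed

lemma length_listing: "finite S \<Longrightarrow> length (listing S) = card S"
  using listing_distinct listing_set by (metis distinct_card)

lemma length_reading: "length (reading r m P) = (\<Sum>q = 1..m. card (col_ones r P q))"
  by (simp add: reading_def length_concat comp_def length_listing interv_sum_list_conv_sum_set_nat
      atLeastLessThanSuc_atLeastAtMost del: upt_Suc)

lemma set_reading: "set (reading r m P) \<subseteq> {1..r}"
  by (auto simp: reading_def listing_set col_ones_def)

lemma map_fst_placed: "map fst (placed row col r m P) = map row (reading r m P)"
  by (simp add: placed_def reading_def map_concat comp_def)

lemma set_placed:
  "set (placed row col r m P) = {(row p, col q) | p q. p \<in> {1..r} \<and> q \<in> {1..m} \<and> P p q = 1}"
  by (auto simp: placed_def listing_set col_ones_def image_iff less_Suc_eq_le simp del: upt_Suc) blast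

text \<open>
  Strictly increasing choices of rows and columns preserve the reading order.
\<close>

lemma sorted_placed:
  assumes row: "strict_mono_on {1..r} row" and col: "strict_mono_on {1..m} col"
  shows "sorted_wrt before (placed row col r m P)"
  using col
proof (induction m)
  case (Suc m)
  have "strict_mono_on {1..m} col" by (rule monotone_on_subset[OF Suc.prems]) auto
  then have IH: "sorted_wrt before (placed row col r m P)" by (rule Suc.IH)
  have split: "placed row col r (Suc m) P =
      placed row col r m P @ map (\<lambda>p. (row p, col (Suc m))) (listing (col_ones r P (Suc m)))"
    by (simp add: placed_def)
  have "sorted_wrt (\<lambda>p p'. before (row p, col (Suc m)) (row p', col (Suc m))) (listing (col_ones r P (Suc m)))"
    by (rule sorted_wrt_mono_rel[OF _ listing_sorted])
      (use lt_mono[OF row] in \<open>auto simp: before_def listing_set col_ones_def\<close>)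
  moreover have "before x (row p, col (Suc m))" if x: "x \<in> set (placed row col r m P)" for x p
  proof -
    obtain q where "q \<in> {1..m}" "snd x = col q" using x by (auto simp: set_placed)
    then show ?thesis using strict_mono_onD[OF Suc.prems, of q "Suc m"] by (auto simp: before_def)
  qed
  ultimately show ?case using IH by (auto simp: split sorted_wrt_append sorted_wrt_map)
qed (simp add: placed_def)

text \<open>
  All three kinds of patterns have this form, with \<open>m = length u\<close> or \<open>m = length u - 1\<close>: as the ones
  number \<open>length u\<close> in total, the value of \<open>m\<close> decides whether there is a double column.
\<close>

definition patterns :: "'a list \<Rightarrow> nat \<Rightarrow> matrix set" where
  "patterns u m = {P. zero_one (card (set u)) m P \<and> (\<forall>q\<in>{1..m}. col_ones (card (set u)) P q \<noteq> {}) \<and>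
     isomorphic u (reading (card (set u)) m P)}"

text \<open>
  The same index sets without mention of a matrix: lists of cells in reading order whose rows spell
  a sequence isomorphic to \<open>u\<close>, with \<open>m\<close> columns in use.
\<close>

definition copy_sets :: "nat \<Rightarrow> nat \<Rightarrow> 'a list \<Rightarrow> nat \<Rightarrow> (nat \<times> nat) set set" where
  "copy_sets n N u m = {set zs | zs. isomorphic u (map fst zs) \<and> sorted_wrt before zs \<and>
     set zs \<subseteq> {1..n} \<times> {1..N} \<and> card (snd ` set zs) = m}"

text \<open>
  A copy of a pattern is listed by \<open>placed\<close>.  Conversely, a list of cells determines the increasing
  enumerations of its rows and of its columns, and with them the matrix; the reading of that matrix is
  the given list because both are sorted and have the same cells.
\<close>

lemma copies_patterns:
  "(\<Union>P\<in>patterns u m. copies n N (card (set u)) m P) = copy_sets n N u m"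
proof (intro equalityI subsetI)
  fix S assume "S \<in> (\<Union>P\<in>patterns u m. copies n N (card (set u)) m P)"
  then obtain P row col where P: "P \<in> patterns u m"
    and row: "strict_mono_on {1..card (set u)} row" "row ` {1..card (set u)} \<subseteq> {1..n}"
    and col: "strict_mono_on {1..m} col" "col ` {1..m} \<subseteq> {1..N}"
    and S: "S = {(row p, col q) | p q. p \<in> {1..card (set u)} \<and> q \<in> {1..m} \<and> P p q = 1}"
    unfolding copies_def by blast
  define zs where "zs = placed row col (card (set u)) m P"
  have S_zs: "S = set zs" by (simp add: S zs_def set_placed)
  have "isomorphic u (map fst zs)"
    unfolding zs_def map_fst_placed
  proof (rule isomorphic_map_left)
    show "inj_on row (set (reading (card (set u)) m P))"
      by (rule inj_on_subset[OF strict_mono_on_imp_inj_on[OF row(1)] set_reading])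
  qed (use P in \<open>simp add: patterns_def\<close>)
  moreover have "sorted_wrt before zs" unfolding zs_def by (rule sorted_placed[OF row(1) col(1)])
  moreover have "set zs \<subseteq> {1..n} \<times> {1..N}" using row(2) col(2) by (auto simp: S_zs[symmetric] S)
  moreover have "card (snd ` set zs) = m"
  proof -
    have "col q \<in> snd ` S" if q: "q \<in> {1..m}" for q
    proof -
      have "col_ones (card (set u)) P q \<noteq> {}" using P q by (simp add: patterns_def)
      then obtain p where "p \<in> {1..card (set u)}" "P p q = 1" by (auto simp: col_ones_def)
      then have "(row p, col q) \<in> S" using q unfolding S by blast
      then show ?thesis by force
    qed
    moreover have "snd ` S \<subseteq> col ` {1..m}" unfolding S by auto
    ultimately have "snd ` set zs = col ` {1..m}" unfolding S_zs by blast
    then show ?thesis using strict_mono_on_imp_inj_on[OF col(1)] by (simp add: card_image)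
  qed
  ultimately show "S \<in> copy_sets n N u m" unfolding copy_sets_def S_zs by blast
next
  fix S assume "S \<in> copy_sets n N u m"
  then obtain zs where S: "S = set zs" and iso: "isomorphic u (map fst zs)"
    and sorted: "sorted_wrt before zs" and grid: "set zs \<subseteq> {1..n} \<times> {1..N}"
    and m: "card (snd ` set zs) = m"
    unfolding copy_sets_def by blast
  have r: "card (fst ` set zs) = card (set u)" using isomorphic_card[OF iso] by simp
  obtain row where row: "strict_mono_on {1..card (set u)} row" "row ` {1..card (set u)} = fst ` set zs"
    using strict_mono_enumeration[of "fst ` set zs"] r by auto
  obtain col where col: "strict_mono_on {1..m} col" "col ` {1..m} = snd ` set zs"
    using strict_mono_enumeration[of "snd ` set zs"] m by auto
  define P :: matrix where "P p q = (if (row p, col q) \<in> set zs then 1 else 0)" for p q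
  have cover: "\<exists>p\<in>{1..card (set u)}. \<exists>q\<in>{1..m}. (a, b) = (row p, col q)" if "(a, b) \<in> set zs" for a b
  proof -
    have "a \<in> row ` {1..card (set u)}" "b \<in> col ` {1..m}" using that row(2) col(2) by force+
    then show ?thesis by blast
  qed
  have set: "set (placed row col (card (set u)) m P) = set zs"
  proof
    show "set (placed row col (card (set u)) m P) \<subseteq> set zs"
      by (auto simp: set_placed P_def split: if_splits)
    show "set zs \<subseteq> set (placed row col (card (set u)) m P)"
    proof
      fix z assume z: "z \<in> set zs"
      then obtain p q where "p \<in> {1..card (set u)}" "q \<in> {1..m}" "z = (row p, col q)"
        using cover by (metis surj_pair)
      moreover from this z have "P p q = 1" by (simp add: P_def)
      ultimately show "z \<in> set (placed row col (card (set u)) m P)" unfolding set_placed by blast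
    qed
  qed
  then have zs: "placed row col (card (set u)) m P = zs"
    using sorted_placed[OF row(1) col(1)] sorted by (intro sorted_before_unique)
  have "isomorphic u (reading (card (set u)) m P)"
  proof -
    have inj: "inj_on row (set (reading (card (set u)) m P))"
      by (rule inj_on_subset[OF strict_mono_on_imp_inj_on[OF row(1)] set_reading])
    show ?thesis using iso unfolding zs[symmetric] map_fst_placed isomorphic_map_iff[OF inj] .
  qed
  moreover have "col_ones (card (set u)) P q \<noteq> {}" if q: "q \<in> {1..m}" for q
  proof -
    obtain a where "(a, col q) \<in> set zs" using q col(2) by force
    moreover from this obtain p where "p \<in> {1..card (set u)}" "a = row p" using cover by blast
    ultimately show ?thesis by (auto simp: col_ones_def P_def)
  qed
  ultimately have "P \<in> patterns u m" by (auto simp: patterns_def zero_one_def P_def)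
  moreover have "S \<in> copies n N (card (set u)) m P"
    unfolding copies_def
  proof (rule CollectI, intro exI conjI)
    show "S = {(row p, col q) | p q. p \<in> {1..card (set u)} \<and> q \<in> {1..m} \<and> P p q = 1}"
      using set by (simp add: S set_placed)
    show "row ` {1..card (set u)} \<subseteq> {1..n}" "col ` {1..m} \<subseteq> {1..N}"
      unfolding row(2) col(2) using grid by auto
  qed fact+
  ultimately show "S \<in> (\<Union>P\<in>patterns u m. copies n N (card (set u)) m P)" by blast
qed

text \<open>
  With one one per column the reading direction is immaterial, so \<open>Pats\<close> fits both directions.
\<close>

lemma reading_single_columns:
  assumes "\<forall>q\<in>{1..m}. card (col_ones r P q) = 1"
  shows "reading r m P = rows_down r m P"
proof -
  have "listing (col_ones r P q) = sorted_list_of_set (col_ones r P q)" if "q \<in> {1..m}" for q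
  proof -
    have "card (col_ones r P q) = 1" using assms that by blast
    then obtain p where p: "col_ones r P q = {p}" by (rule card_1_singletonE)
    have "length (listing {p}) = 1" "set (listing {p}) = {p}" by (simp_all add: length_listing listing_set)
    then have "listing {p} = [p]" by (auto simp: length_Suc_conv)
    then show ?thesis by (simp add: p)
  qed
  then show ?thesis unfolding reading_def rows_down_def
    by (intro arg_cong[of _ _ concat] map_cong) auto
qed

lemma u_pattern_iff: "u_pattern u P \<longleftrightarrow> P \<in> patterns u (length u)"
proof -
  define r l where "r = card (set u)" and "l = length u"
  have "(\<forall>q\<in>{1..l}. card (col_ones r P q) = 1) \<and> isomorphic u (rows_down r l P) \<longleftrightarrow>
    (\<forall>q\<in>{1..l}. col_ones r P q \<noteq> {}) \<and> isomorphic u (reading r l P)"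
    using all_one_iff_sum[of "{1..l}" "\<lambda>q. card (col_ones r P q)"] reading_single_columns[of l r P]
      isomorphic_length[of u "reading r l P"] isomorphic_length[of u "rows_down r l P"]
    by (auto simp: length_reading l_def)
  then show ?thesis by (simp add: u_pattern_def patterns_def Let_def r_def l_def)
qed

lemma double_column_pattern_iff:
  assumes "u \<noteq> []"
  shows "zero_one (card (set u)) (length u - 1) P \<and> one_double_column (card (set u)) (length u - 1) P \<and>
    isomorphic u (reading (card (set u)) (length u - 1) P) \<longleftrightarrow> P \<in> patterns u (length u - 1)"
proof -
  define r m where "r = card (set u)" and "m = length u - 1"
  have l: "length u = Suc m" using assms by (simp add: m_def)
  have "one_double_column r m P \<longleftrightarrow> (\<forall>q\<in>{1..m}. col_ones r P q \<noteq> {})" if "isomorphic u (reading r m P)"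
    using isomorphic_length[OF that] one_two_iff_sum[of "{1..m}" "\<lambda>q. card (col_ones r P q)"]
    by (simp add: length_reading l one_double_column_def)
  then show ?thesis unfolding patterns_def r_def m_def by auto
qed

lemma Pats_eq: "Pats n N u = copy_sets n N u (length u)"
  by (simp add: Pats_def u_pattern_iff copies_patterns[symmetric])

lemma card_copy_set: "S \<in> copy_sets n N u m \<Longrightarrow> card S = length u"
  unfolding copy_sets_def using isomorphic_length sorted_before_distinct distinct_card by force

lemma copy_sets_grid: "S \<in> copy_sets n N u m \<Longrightarrow> S \<subseteq> {1..n} \<times> {1..N}"
  unfolding copy_sets_def by auto

text \<open>
  Take any \<open>length u\<close> columns including \<open>j\<close>, and an injective renaming of the letters that sends the
  letter of \<open>u\<close> standing in column \<open>j\<close> to row \<open>i\<close>.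
\<close>

lemma copy_set_through_cell:
  assumes u: "u \<noteq> []" and n: "card (set u) \<le> n" and N: "length u \<le> N"
    and i: "i \<in> {1..n}" and j: "j \<in> {1..N}"
  shows "\<exists>S\<in>copy_sets n N u (length u). (i, j) \<in> S"
proof -
  have "length u - 1 \<le> card ({1..N} - {j})" using N j by simp
  then obtain C where C: "C \<subseteq> {1..N} - {j}" "card C = length u - 1"
    by (metis obtain_subset_with_card_n)
  define cs where "cs = sorted_list_of_set (insert j C)"
  have finC: "finite C" using C(1) finite_subset by blast
  have "card (insert j C) = length u" using C u finC by (subst card_insert_disjoint) auto
  then have cs: "set cs = insert j C" "sorted_wrt (<) cs" "length cs = length u"
    using finC unfolding cs_def by (simp_all del: sorted_list_of_set_insert_remove)
  obtain q where q: "q < length u" "cs ! q = j" using cs by (metis in_set_conv_nth insertI1)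
  define a where "a = u ! q"
  have a: "a \<in> set u" using q by (simp add: a_def)
  have "card (set u - {a}) \<le> card ({1..n} - {i})" using n a i by simp
  then obtain f where f: "f ` (set u - {a}) \<subseteq> {1..n} - {i}" "inj_on f (set u - {a})"
    by (metis List.finite_set finite_Diff finite_atLeastAtMost card_le_inj)
  define g where "g = f(a := i)"
  have g_inj: "inj_on g (set u)"
  proof (rule inj_onI)
    fix x y assume "x \<in> set u" "y \<in> set u" "g x = g y"
    then show "x = y" using f by (cases "x = a"; cases "y = a") (auto simp: g_def inj_on_def)
  qed
  have g_n: "g ` set u \<subseteq> {1..n}" using f(1) i by (auto simp: g_def)
  define zs where "zs = zip (map g u) cs"
  have zs: "map fst zs = map g u" "map snd zs = cs" using cs(3) by (simp_all add: zs_def)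
  have "set zs \<in> copy_sets n N u (length u)"
    unfolding copy_sets_def
  proof (rule CollectI, intro exI conjI)
    show "isomorphic u (map fst zs)" using g_inj by (auto simp: zs isomorphic_def)
    have "sorted_wrt (\<lambda>x y. snd x < snd y) zs" using cs(2) by (simp add: zs(2)[symmetric] sorted_wrt_map)
    then show "sorted_wrt before zs" by (rule sorted_wrt_mono_rel[rotated]) (simp add: before_def)
    show "set zs \<subseteq> {1..n} \<times> {1..N}"
    proof -
      have "set zs \<subseteq> set (map g u) \<times> set cs"
        unfolding zs_def by (auto dest: set_zip_leftD set_zip_rightD simp del: set_map)
      also have "\<dots> \<subseteq> {1..n} \<times> {1..N}" using g_n cs(1) C(1) j by (intro Sigma_mono) auto
      finally show ?thesis .
    qed
    have "snd ` set zs = set cs" by (metis zs(2) set_map)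
    then show "card (snd ` set zs) = length u" using cs(2,3) by (metis distinct_card strict_sorted_iff)
  qed simp
  moreover have "(i, j) \<in> set zs"
  proof -
    have "zs ! q = (i, j)" using q cs(3) by (simp add: zs_def g_def a_def)
    then show ?thesis using q cs(3) by (metis length_map length_zip min.idem nth_mem zs_def)
  qed
  ultimately show ?thesis by blast
qed

end

text \<open>
  Rows are numbered from the top, so reading downwards means increasing row numbers.
\<close>

interpretation down: column_reading "(<)" sorted_list_of_set
  by unfold_locales auto

interpretation up: column_reading "(>)" "\<lambda>S. rev (sorted_list_of_set S)"
  by unfold_locales (auto simp: sorted_wrt_rev)

lemma Pats_plus_eq:
  assumes "u \<noteq> []"
  shows "Pats_plus n N u = down.copy_sets n N u (length u - 1)"
proof -
  have "down.reading = rows_down" by (simp add: fun_eq_iff down.reading_def rows_down_def)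
  then have "u_plus_pattern u P \<longleftrightarrow> P \<in> down.patterns u (length u - 1)" for P
    using down.double_column_pattern_iff[OF assms, of P] by (simp only: u_plus_pattern_def Let_def)
  then show ?thesis by (simp only: Pats_plus_def down.copies_patterns[symmetric] Collect_mem_eq)
qed

lemma Pats_minus_eq:
  assumes "u \<noteq> []"
  shows "Pats_minus n N u = up.copy_sets n N u (length u - 1)"
proof -
  have "up.reading = rows_up" by (simp add: fun_eq_iff up.reading_def rows_up_def)
  then have "u_minus_pattern u P \<longleftrightarrow> P \<in> up.patterns u (length u - 1)" for P
    using up.double_column_pattern_iff[OF assms, of P] by (simp only: u_minus_pattern_def Let_def)
  then show ?thesis by (simp only: Pats_minus_def up.copies_patterns[symmetric] Collect_mem_eq)
qed

section \<open>Sequences as 0-1 assignments\<close>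

definition word_cells :: "nat list \<Rightarrow> (nat \<times> nat) list" where
  "word_cells s = zip s [1..<Suc (length s)]"

lemma length_word_cells [simp]: "length (word_cells s) = length s"
  by (simp add: word_cells_def del: upt_Suc)

lemma nth_word_cells: "p < length s \<Longrightarrow> word_cells s ! p = (s ! p, Suc p)"
  by (simp add: word_cells_def del: upt_Suc)

lemma map_fst_word_cells [simp]: "map fst (word_cells s) = s"
  by (simp add: word_cells_def del: upt_Suc)

lemma in_word_cells_iff: "(i, j) \<in> set (word_cells s) \<longleftrightarrow> 1 \<le> j \<and> j \<le> length s \<and> s ! (j - 1) = i"
proof
  assume "(i, j) \<in> set (word_cells s)"
  then show "1 \<le> j \<and> j \<le> length s \<and> s ! (j - 1) = i"
    by (auto simp: in_set_conv_nth nth_word_cells)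
next
  assume "1 \<le> j \<and> j \<le> length s \<and> s ! (j - 1) = i"
  then have "j - 1 < length (word_cells s)" "word_cells s ! (j - 1) = (i, j)"
    by (auto simp: nth_word_cells)
  then show "(i, j) \<in> set (word_cells s)" by (metis nth_mem)
qed

lemma inj_on_snd_word_cells: "inj_on snd (set (word_cells s))"
  by (auto simp: inj_on_def in_word_cells_iff)

lemma word_cells_grid:
  assumes "set s \<subseteq> {1..n}" "length s \<le> N"
  shows "set (word_cells s) \<subseteq> {1..n} \<times> {1..N}"
proof (rule subrelI)
  fix i j assume ij: "(i, j) \<in> set (word_cells s)"
  then have "s ! (j - 1) \<in> set s" by (intro nth_mem) (auto simp: in_word_cells_iff)
  then show "(i, j) \<in> {1..n} \<times> {1..N}" using ij assms by (auto simp: in_word_cells_iff)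
qed

text \<open>
  The word \<open>s\<close> is written into the first \<open>length s\<close> columns; all later columns are zero.
\<close>

definition encodes :: "nat \<Rightarrow> nat \<Rightarrow> (nat \<Rightarrow> nat \<Rightarrow> int) \<Rightarrow> nat list \<Rightarrow> bool" where
  "encodes n N x s \<longleftrightarrow> set s \<subseteq> {1..n} \<and> length s \<le> N \<and>
     (\<forall>i\<in>{1..n}. \<forall>j\<in>{1..N}. x i j = of_bool ((i, j) \<in> set (word_cells s)))"

lemma encodes_letter:
  assumes "encodes n N x s" "1 \<le> j" "j \<le> length s"
  shows "s ! (j - 1) \<in> {1..n}"
proof -
  have "s ! (j - 1) \<in> set s" using assms(2,3) by (intro nth_mem) auto
  then show ?thesis using assms(1) by (auto simp: encodes_def)
qed

lemma f_val_encodes: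
  assumes "encodes n N x s" "S \<subseteq> {1..n} \<times> {1..N}"
  shows "f_val x S = int (card (S \<inter> set (word_cells s)))"
proof -
  have "finite S" using assms(2) by (rule finite_subset) simp
  have "f_val x S = (\<Sum>z\<in>S. of_bool (z \<in> set (word_cells s)))"
    unfolding f_val_def using assms by (intro sum.cong) (auto simp: encodes_def)
  then show ?thesis using \<open>finite S\<close> by simp
qed

lemma sum_column_encodes:
  assumes "encodes n N x s" "T \<subseteq> {1..n}" "j \<in> {1..N}"
  shows "(\<Sum>t\<in>T. x t j) = of_bool (j \<le> length s \<and> s ! (j - 1) \<in> T)"
proof -
  have "finite T" using assms(2) by (rule finite_subset) simp
  have "(\<Sum>t\<in>T. x t j) = (\<Sum>t\<in>T. if t = s ! (j - 1) then of_bool (j \<le> length s) else 0)"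
    using assms by (intro sum.cong) (auto simp: encodes_def in_word_cells_iff)
  also have "\<dots> = of_bool (j \<le> length s \<and> s ! (j - 1) \<in> T)"
    using \<open>finite T\<close> by (subst sum.delta) auto
  finally show ?thesis .
qed

lemma window_sum_encodes:
  assumes "encodes n N x s" "i \<in> {1..n}"
  shows "(\<Sum>t=a..b. xz N x i t) = int (card {t\<in>{a..b}. 1 \<le> t \<and> t \<le> int (length s) \<and> s ! (nat t - 1) = i})"
proof -
  have "xz N x i t = of_bool (1 \<le> t \<and> t \<le> int (length s) \<and> s ! (nat t - 1) = i)" for t
  proof (cases "1 \<le> t \<and> t \<le> int N")
    case True
    then have "nat t \<in> {1..N}" by auto
    then have "x i (nat t) = of_bool ((i, nat t) \<in> set (word_cells s))"
      using assms by (simp add: encodes_def)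
    moreover have "1 \<le> nat t" "nat t \<le> length s \<longleftrightarrow> t \<le> int (length s)" using True by linarith+
    ultimately show ?thesis using True by (simp add: xz_def in_word_cells_iff)
  next
    case False
    then show ?thesis using assms(1) by (auto simp: xz_def encodes_def)
  qed
  then have "(\<Sum>t=a..b. xz N x i t) = (\<Sum>t=a..b. of_bool (1 \<le> t \<and> t \<le> int (length s) \<and> s ! (nat t - 1) = i))"
    by (rule sum.cong[OF refl])
  then show ?thesis by (simp add: Int_def)
qed

lemma insertion_window_pos_iff:
  assumes "encodes n N x s" "i \<in> {1..n}" "sparse r s" "k \<le> length s" "r \<ge> 1"
  shows "0 < (\<Sum>t=int k - int r + 2..int k + int r - 1. xz N x i t) \<longleftrightarrow> \<not> sparse r (insert_at k i s)"
proof -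
  have witness: "(\<exists>t\<in>{int k - int r + 2..int k + int r - 1}. 1 \<le> t \<and> t \<le> int (length s) \<and> s ! (nat t - 1) = i) \<longleftrightarrow>
    (\<exists>p<length s. k < p + r \<and> p + 1 < k + r \<and> s ! p = i)" (is "?L \<longleftrightarrow> ?R")
  proof
    assume ?L
    then obtain t where t: "int k - int r + 2 \<le> t" "t \<le> int k + int r - 1" "1 \<le> t" "t \<le> int (length s)"
      "s ! (nat t - 1) = i" by auto
    have "nat t - 1 < length s" "k < nat t - 1 + r" "nat t - 1 + 1 < k + r" using t by linarith+
    then show ?R using t(5) by blast
  next
    assume ?R
    then obtain p where p: "p < length s" "k < p + r" "p + 1 < k + r" "s ! p = i" by blast
    have "int (Suc p) \<in> {int k - int r + 2..int k + int r - 1}" using p by auto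
    moreover have "nat (int (Suc p)) - 1 = p" by (simp only: nat_int diff_Suc_1)
    moreover have "1 \<le> int (Suc p)" "int (Suc p) \<le> int (length s)" using p(1) by linarith+
    ultimately show ?L using p(4) by metis
  qed
  have "finite {t\<in>{a..b}. Q t}" for a b :: int and Q
    by (rule finite_subset[of _ "{a..b}"]) auto
  then have card_pos: "0 < int (card {t\<in>{a..b}. Q t}) \<longleftrightarrow> (\<exists>t\<in>{a..b}. Q t)" for a b :: int and Q
    unfolding of_nat_0_less_iff card_gt_0_iff by blast
  show ?thesis
    unfolding window_sum_encodes[OF assms(1,2)] sparse_insert_at_iff[OF assms(3,4,5)] card_pos witness by blast
qed

text \<open>
  The windows of the program lie inside the grid, whereas two equal letters may stand near the right
  end.  Any two positions at distance less than \<open>r\<close> still share a window: if the one starting at the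
  first position would leave the grid, the last window serves.
\<close>

lemma sparse_iff_windows:
  assumes enc: "encodes n N x s" and r: "r \<ge> 1" and N: "r \<le> N"
  shows "(\<forall>i\<in>{1..n}. \<forall>j\<in>{1..N + 1 - r}. (\<Sum>t=int j..int j + int r - 1. xz N x i t) \<le> 1) \<longleftrightarrow> sparse r s"
proof
  assume L: "\<forall>i\<in>{1..n}. \<forall>j\<in>{1..N + 1 - r}. (\<Sum>t=int j..int j + int r - 1. xz N x i t) \<le> 1"
  show "sparse r s"
    unfolding sparse_iff_nth
  proof (intro allI impI notI)
    fix p q assume pq: "p < q" "q < length s" "q < p + r" and eq: "s ! p = s ! q"
    define j where "j = min (Suc p) (N + 1 - r)"
    have len: "length s \<le> N" using enc by (simp add: encodes_def)
    have j: "j \<in> {1..N + 1 - r}" using N by (auto simp: j_def)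
    have i: "s ! p \<in> {1..n}" using enc pq nth_mem[of p s] unfolding encodes_def by (meson less_trans subsetD)
    let ?T = "{t\<in>{int j..int j + int r - 1}. 1 \<le> t \<and> t \<le> int (length s) \<and> s ! (nat t - 1) = s ! p}"
    have "int (Suc p) \<in> {int j..int j + int r - 1}" "int (Suc q) \<in> {int j..int j + int r - 1}"
      using pq len N by (auto simp: j_def min_def)
    moreover have "nat (int (Suc m)) - 1 = m" for m by (simp only: nat_int diff_Suc_1)
    moreover have "1 \<le> int (Suc p)" "int (Suc p) \<le> int (length s)" "1 \<le> int (Suc q)" "int (Suc q) \<le> int (length s)"
      using pq by linarith+
    ultimately have "{int (Suc p), int (Suc q)} \<subseteq> ?T" using eq[symmetric] by simp
    moreover have "finite ?T" by (rule finite_subset[of _ "{int j..int j + int r - 1}"]) auto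
    ultimately have "card {int (Suc p), int (Suc q)} \<le> card ?T" by (intro card_mono)
    then show False
      using L[rule_format, OF i j] pq unfolding window_sum_encodes[OF enc i] by simp
  qed
next
  assume sp: "sparse r s"
  show "\<forall>i\<in>{1..n}. \<forall>j\<in>{1..N + 1 - r}. (\<Sum>t=int j..int j + int r - 1. xz N x i t) \<le> 1"
  proof (intro ballI)
    fix i j assume i: "i \<in> {1..n}" and j: "j \<in> {1..N + 1 - r}"
    have "t = t'" if t: "t \<in> {int j..int j + int r - 1}" "1 \<le> t" "t \<le> int (length s)" "s ! (nat t - 1) = i"
      and t': "t' \<in> {int j..int j + int r - 1}" "1 \<le> t'" "t' \<le> int (length s)" "s ! (nat t' - 1) = i" for t t'
    proof -
      have "nat t - 1 < length s" "nat t' - 1 < length s"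
        "nat t' - 1 < nat t - 1 + r" "nat t - 1 < nat t' - 1 + r"
        using t(1-3) t'(1-3) unfolding atLeastAtMost_iff by linarith+
      moreover have "s ! (nat t - 1) = s ! (nat t' - 1)" using t(4) t'(4) by simp
      ultimately have "\<not> nat t - 1 < nat t' - 1" "\<not> nat t' - 1 < nat t - 1"
        using sp unfolding sparse_iff_nth by metis+
      then show ?thesis using t(2) t'(2) by linarith
    qed
    moreover have fin: "finite {t\<in>{int j..int j + int r - 1}. 1 \<le> t \<and> t \<le> int (length s) \<and> s ! (nat t - 1) = i}"
      by (rule finite_subset[of _ "{int j..int j + int r - 1}"]) auto
    ultimately have "card {t\<in>{int j..int j + int r - 1}. 1 \<le> t \<and> t \<le> int (length s) \<and> s ! (nat t - 1) = i} \<le> Suc 0"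
      unfolding card_le_Suc0_iff_eq[OF fin] by blast
    then show "(\<Sum>t=int j..int j + int r - 1. xz N x i t) \<le> 1"
      unfolding window_sum_encodes[OF enc i] by simp
  qed
qed

section \<open>Copies of the forbidden sequence in a word\<close>

context column_reading
begin

text \<open>
  For a list of cells in reading order, a copy of \<open>u\<close> among its rows is the same as a copy set
  contained in its cells.
\<close>

lemma contains_copy_cells_iff:
  assumes W: "sorted_wrt before W" and grid: "set W \<subseteq> {1..n} \<times> {1..N}"
  shows "contains_copy (map fst W) u \<longleftrightarrow> (\<exists>m. \<exists>S\<in>copy_sets n N u m. S \<subseteq> set W)"
proof
  assume "contains_copy (map fst W) u"
  then obtain t where "subseq t (map fst W)" "isomorphic u t" by (auto simp: contains_copy_def)
  then obtain I where "isomorphic u (map fst (nths W I))" by (auto simp: subseq_conv_nths nths_map)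
  moreover have sub: "set (nths W I) \<subseteq> set W" by (rule set_nths_subset)
  moreover have "sorted_wrt before (nths W I)"
    using W by (induction W arbitrary: I) (auto simp: nths_Cons dest: in_set_nthsD)
  ultimately have "set (nths W I) \<in> copy_sets n N u (card (snd ` set (nths W I)))"
    using grid unfolding copy_sets_def by blast
  then show "\<exists>m. \<exists>S\<in>copy_sets n N u m. S \<subseteq> set W" using sub by blast
next
  assume "\<exists>m. \<exists>S\<in>copy_sets n N u m. S \<subseteq> set W"
  then obtain zs where "isomorphic u (map fst zs)" "sorted_wrt before zs" "set zs \<subseteq> set W"
    by (auto simp: copy_sets_def)
  moreover from this have "subseq (map fst zs) (map fst W)"
    using W by (intro subseq_map subseq_of_sorted_before)
  ultimately show "contains_copy (map fst W) u" unfolding contains_copy_def by blast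
qed

lemma sorted_word_cells: "sorted_wrt before (word_cells s)"
  by (simp add: sorted_wrt_iff_nth_less nth_word_cells before_def)

lemma contains_copy_word_iff:
  assumes "set s \<subseteq> {1..n}" "length s \<le> N"
  shows "contains_copy s u \<longleftrightarrow> (\<exists>m. \<exists>S\<in>copy_sets n N u m. S \<subseteq> set (word_cells s))"
  using contains_copy_cells_iff[OF sorted_word_cells word_cells_grid[OF assms]] by simp

lemma copy_set_in_word_columns:
  assumes "S \<in> copy_sets n N u m" "S \<subseteq> set (word_cells s)"
  shows "m = length u"
proof -
  have "card (snd ` S) = card S"
    using assms(2) by (intro card_image inj_on_subset[OF inj_on_snd_word_cells])
  moreover have "card (snd ` S) = m" using assms(1) by (auto simp: copy_sets_def)
  ultimately show ?thesis using card_copy_set[OF assms(1)] by simp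
qed

text \<open>
  The cells of a word leave no column free for a new letter, so a letter \<open>i\<close> inserted after the first
  \<open>k\<close> letters is put into the column \<open>j\<close> of a neighbour: \<open>j = k + 1\<close> if it comes before that
  neighbour and \<open>j = k\<close> if it comes after it.  The new cell lands at the right place of the reading
  order exactly when the two rows compare accordingly; for two different letters this happens in one of
  the two reading directions.
\<close>

definition fits :: "nat list \<Rightarrow> nat \<Rightarrow> nat \<Rightarrow> nat \<Rightarrow> bool" where
  "fits s i j k \<longleftrightarrow> j = Suc k \<and> lt i (s ! (j - 1)) \<or> j = k \<and> lt (s ! (j - 1)) i"

lemma sorted_insert_cell:
  assumes j: "1 \<le> j" "j \<le> length s" and fit: "fits s i j k"
  shows "sorted_wrt before (insert_at k (i, j) (word_cells s))"
proof -
  have k: "k \<le> length (word_cells s)" using fit j by (auto simp: fits_def)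
  have "before (word_cells s ! p) (i, j)" if "p < k" for p
  proof (cases "Suc p = k")
    case True
    then show ?thesis using that k fit by (auto simp: nth_word_cells before_def fits_def)
  next
    case False
    then show ?thesis using that k fit by (auto simp: nth_word_cells before_def fits_def)
  qed
  moreover have "before (i, j) (word_cells s ! p)" if "k \<le> p" "p < length s" for p
    using that fit by (auto simp: nth_word_cells before_def fits_def le_less)
  moreover have "before (word_cells s ! p) (word_cells s ! q)" if "p < q" "q < length s" for p q
    using that by (simp add: nth_word_cells before_def)
  ultimately show ?thesis
    using k by (auto simp: sorted_wrt_iff_nth_less nth_insert_at)
qed

text \<open>
  A copy created by the insertion uses the new cell \<open>(i, j)\<close>.  It uses all \<open>length u\<close> columns separately if it
  omits the neighbour in column \<open>j\<close>, and has \<open>j\<close> as its only double column if it includes it.  This is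
  why both ordinary patterns and patterns with a double column occur in the program.
\<close>

lemma contains_copy_insert_iff:
  assumes av: "avoids s u" and s: "set s \<subseteq> {1..n}" "length s \<le> N"
    and i: "i \<in> {1..n}" and j: "1 \<le> j" "j \<le> length s" and fit: "fits s i j k"
  shows "contains_copy (insert_at k i s) u \<longleftrightarrow>
    (\<exists>S\<in>copy_sets n N u (length u) \<union> copy_sets n N u (length u - 1).
       (i, j) \<in> S \<and> S - {(i, j)} \<subseteq> set (word_cells s))" (is "?L \<longleftrightarrow> ?R")
proof -
  have L_iff: "?L \<longleftrightarrow> (\<exists>m. \<exists>S\<in>copy_sets n N u m. S \<subseteq> insert (i, j) (set (word_cells s)))"
    using contains_copy_cells_iff[OF sorted_insert_cell[OF j fit], of n N u]
      word_cells_grid[OF s] i j s by (simp add: map_insert_at set_insert_at)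
  show ?thesis
  proof
    assume ?L
    then obtain m S where S: "S \<in> copy_sets n N u m" "S \<subseteq> insert (i, j) (set (word_cells s))"
      unfolding L_iff by blast
    have ij: "(i, j) \<in> S" using S av contains_copy_word_iff[OF s, of u] by blast
    have fin: "finite S" using S(2) finite_subset by blast
    have "card (S - {(i, j)}) = length u - 1"
      using ij fin card_copy_set[OF S(1)] by simp
    moreover have "inj_on snd (S - {(i, j)})"
      by (rule inj_on_subset[OF inj_on_snd_word_cells[of s]]) (use S(2) in blast)
    ultimately have c: "card (snd ` (S - {(i, j)})) = length u - 1" by (simp add: card_image)
    have "snd ` S = insert j (snd ` (S - {(i, j)}))" using ij by force
    then have "m = card (insert j (snd ` (S - {(i, j)})))" using S(1) by (auto simp: copy_sets_def)
    moreover have "length u \<noteq> 0" using card_copy_set[OF S(1)] ij fin by auto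
    ultimately have "m = length u \<or> m = length u - 1" using c fin by (auto simp: card_insert_if)
    then show ?R using S ij by blast
  next
    assume ?R
    then show ?L unfolding L_iff by blast
  qed
qed

section \<open>The insertion constraints\<close>

text \<open>
  The common form of the left-hand sides of the four insertion constraints.  Here \<open>k\<close> is \<open>j - 1\<close> or
  \<open>j\<close>, the number of letters in front of the gap.  The three terms ask: does the insertion create a
  copy of \<open>u\<close>; does column \<open>j\<close> hold a letter in the right order relative to \<open>i\<close>; does the insertion violate
  sparsity.
\<close>

definition insertion_slack ::
  "nat \<Rightarrow> nat \<Rightarrow> 'a list \<Rightarrow> (nat \<Rightarrow> nat \<Rightarrow> int) \<Rightarrow> ((nat \<times> nat) set \<Rightarrow> int) \<Rightarrow> nat \<Rightarrow> nat \<Rightarrow> nat \<Rightarrow> int"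
where
  "insertion_slack n N u x y i j k =
     (\<Sum>S\<in>{S\<in>copy_sets n N u (length u) \<union> copy_sets n N u (length u - 1). (i, j) \<in> S}. y S)
     - (\<Sum>t\<in>{t\<in>{1..n}. if k < j then lt i t else lt t i}. x t j)
     + (\<Sum>t=int k - int (card (set u)) + 2..int k + int (card (set u)) - 1. xz N x i t)"

definition insertion_constraints ::
  "nat \<Rightarrow> nat \<Rightarrow> 'a list \<Rightarrow> (nat \<Rightarrow> nat \<Rightarrow> int) \<Rightarrow> ((nat \<times> nat) set \<Rightarrow> int) \<Rightarrow> bool"
where
  "insertion_constraints n N u x y \<longleftrightarrow>
     (\<forall>i\<in>{1..n}. \<forall>j\<in>{1..N}. 0 \<le> insertion_slack n N u x y i j (j - 1) \<and> 0 \<le> insertion_slack n N u x y i j j)"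

lemma finite_copy_sets: "finite (copy_sets n N u m)"
  by (rule finite_subset[of _ "Pow ({1..n} \<times> {1..N})"]) (use copy_sets_grid in blast, simp)

text \<open>
  The subtracted sum is 0 or 1 because a column holds at most one letter, so the inequality says that
  if a letter is there to be a neighbour, then one of the other two terms is positive.  The new cell
  carries the value 0, so a selector \<open>y S\<close> of a set through it is 1 exactly when all other cells of \<open>S\<close> are
  occupied.
\<close>

lemma insertion_slack_nonneg_iff:
  assumes enc: "encodes n N x s" and sp: "sparse (card (set u)) s" and av: "avoids s u"
    and u: "card (set u) \<ge> 1"
    and y: "\<And>S. S \<in> copy_sets n N u (length u) \<union> copy_sets n N u (length u - 1) \<Longrightarrow>
      y S = of_bool (int (length u) - 1 \<le> f_val x S)"
    and i: "i \<in> {1..n}" and j: "j \<in> {1..N}" and k: "j = Suc k \<or> j = k"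
  shows "0 \<le> insertion_slack n N u x y i j k \<longleftrightarrow>
    (j \<le> length s \<and> fits s i j k \<longrightarrow>
      \<not> sparse (card (set u)) (insert_at k i s) \<or> contains_copy (insert_at k i s) u)"
proof -
  define C where "C = copy_sets n N u (length u) \<union> copy_sets n N u (length u - 1)"
  define Y where "Y = (\<Sum>S\<in>{S\<in>C. (i, j) \<in> S}. y S)"
  define wd where "wd = (\<Sum>t=int k - int (card (set u)) + 2..int k + int (card (set u)) - 1. xz N x i t)"
  have s: "set s \<subseteq> {1..n}" "length s \<le> N" using enc by (simp_all add: encodes_def)
  have finC: "finite {S\<in>C. (i, j) \<in> S}" by (simp add: C_def finite_copy_sets)
  have y01: "y S \<in> {0, 1}" if "S \<in> C" for S using y that by (simp add: C_def)
  have Y0: "0 \<le> Y" unfolding Y_def using y01 by (intro sum_nonneg) fastforce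
  have wd0: "0 \<le> wd" unfolding wd_def window_sum_encodes[OF enc i] by simp
  have col: "(\<Sum>t\<in>{t\<in>{1..n}. if k < j then lt i t else lt t i}. x t j)
      = of_bool (j \<le> length s \<and> fits s i j k)"
  proof -
    have "s ! (j - 1) \<in> {1..n}" if "j \<le> length s"
      using encodes_letter[OF enc _ that] j by simp
    then have eq: "j \<le> length s \<and> s ! (j - 1) \<in> {t\<in>{1..n}. if k < j then lt i t else lt t i} \<longleftrightarrow>
      j \<le> length s \<and> fits s i j k"
      using k by (auto simp: fits_def)
    have sub: "{t\<in>{1..n}. if k < j then lt i t else lt t i} \<subseteq> {1..n}" by blast
    show ?thesis unfolding sum_column_encodes[OF enc sub j] eq ..
  qed
  have slack: "insertion_slack n N u x y i j k = Y - of_bool (j \<le> length s \<and> fits s i j k) + wd"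
    unfolding insertion_slack_def Y_def C_def wd_def col ..
  show ?thesis
  proof (cases "j \<le> length s \<and> fits s i j k")
    case False
    then show ?thesis using Y0 wd0 by (auto simp: slack)
  next
    case True
    then have jl: "j \<le> length s" and fit: "fits s i j k" by auto
    have "s ! (j - 1) \<noteq> i" using fit lt by (auto simp: fits_def)
    then have notin: "(i, j) \<notin> set (word_cells s)" by (simp add: in_word_cells_iff)
    have y1: "y S = 1 \<longleftrightarrow> S - {(i, j)} \<subseteq> set (word_cells s)" if S: "S \<in> C" "(i, j) \<in> S" for S
    proof -
      have grid: "S \<subseteq> {1..n} \<times> {1..N}" and card: "card S = length u"
        using S(1) copy_sets_grid card_copy_set unfolding C_def by blast+
      have fin: "finite S" using grid by (rule finite_subset) simp
      have card': "card (S - {(i, j)}) = length u - 1" using S fin card by simp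
      have "length u \<noteq> 0" using S fin card by auto
      then have "y S = 1 \<longleftrightarrow> length u - 1 \<le> card (S \<inter> set (word_cells s))"
        using y[of S] S(1) f_val_encodes[OF enc grid] unfolding C_def by (simp add: of_bool_def) linarith
      also have "\<dots> \<longleftrightarrow> S - {(i, j)} \<subseteq> set (word_cells s)"
      proof
        assume "length u - 1 \<le> card (S \<inter> set (word_cells s))"
        then have "S \<inter> set (word_cells s) = S - {(i, j)}"
          using notin fin card' by (intro card_seteq) auto
        then show "S - {(i, j)} \<subseteq> set (word_cells s)" by blast
      next
        assume "S - {(i, j)} \<subseteq> set (word_cells s)"
        then have "S - {(i, j)} \<subseteq> S \<inter> set (word_cells s)" by blast
        then have "card (S - {(i, j)}) \<le> card (S \<inter> set (word_cells s))"
          using fin by (intro card_mono) auto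
        then show "length u - 1 \<le> card (S \<inter> set (word_cells s))" using card' by simp
      qed
      finally show ?thesis .
    qed
    have "0 < Y \<longleftrightarrow> (\<exists>S\<in>C. (i, j) \<in> S \<and> y S = 1)"
    proof -
      have "Y = 0 \<longleftrightarrow> (\<forall>S\<in>{S\<in>C. (i, j) \<in> S}. y S = 0)"
        unfolding Y_def using finC y01 by (intro sum_nonneg_eq_0_iff) fastforce+
      then show ?thesis using Y0 y01 by fastforce
    qed
    also have "\<dots> \<longleftrightarrow> contains_copy (insert_at k i s) u"
      using contains_copy_insert_iff[OF av s i _ jl fit] y1 j unfolding C_def by auto
    finally have Y: "0 < Y \<longleftrightarrow> contains_copy (insert_at k i s) u" .
    have "k \<le> length s" using k jl by auto
    then have "0 < wd \<longleftrightarrow> \<not> sparse (card (set u)) (insert_at k i s)"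
      unfolding wd_def using insertion_window_pos_iff[OF enc i sp _ u] by blast
    then show ?thesis using True Y Y0 wd0 unfolding slack by auto
  qed
qed

end

section \<open>The program describes saturated sequences\<close>

text \<open>
  All constraints of the program except the four families about insertions.
\<close>

definition structural_constraints ::
  "nat \<Rightarrow> nat \<Rightarrow> 'a list \<Rightarrow> (nat \<Rightarrow> nat \<Rightarrow> int) \<Rightarrow> ((nat \<times> nat) set \<Rightarrow> int) \<Rightarrow> bool" where
  "structural_constraints n N u x y \<longleftrightarrow>
     (let l = int (length u); r = int (card (set u)) in
      (\<forall>i\<in>{1..n}. \<forall>j\<in>{1..N}. x i j \<in> {0, 1}) \<and>
      (\<forall>P'\<in>Pats n N u. f_val x P' < l) \<and>
      (\<forall>P'\<in>Pats_all n N u. y P' \<in> {0, 1} \<and> (l - 1) * y P' - f_val x P' \<le> 0 \<and> y P' - f_val x P' \<ge> - l + 2) \<and>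
      (\<forall>j\<in>{1..N}. (\<Sum>i=1..n. x i j) \<le> 1) \<and>
      (\<forall>j\<in>{1..N - 1}. (\<Sum>i=1..n. x i j) \<ge> (\<Sum>i=1..n. x i (j + 1))) \<and>
      (\<forall>i\<in>{1..n}. \<forall>j\<in>{1..N + 1 - card (set u)}.
         (\<Sum>t=int j..int j + r - 1. xz N x i t) \<le> 1) \<and>
      (\<forall>i\<in>{1..card (set u) - 1}. x i i = 1))"

lemma copy_sets_full_down_up: "up.copy_sets n N u (length u) = down.copy_sets n N u (length u)"
  by (metis down.Pats_eq up.Pats_eq)

lemma Pats_all_copy_set:
  assumes "u \<noteq> []" "S \<in> Pats_all n N u"
  obtains m where "S \<in> down.copy_sets n N u m" | m where "S \<in> up.copy_sets n N u m"
  using assms(2) unfolding Pats_all_def Pats_plus_eq[OF assms(1)] Pats_minus_eq[OF assms(1)] down.Pats_eq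
  by blast

lemma Pats_all_grid: "u \<noteq> [] \<Longrightarrow> S \<in> Pats_all n N u \<Longrightarrow> S \<subseteq> {1..n} \<times> {1..N}"
  by (erule (1) Pats_all_copy_set) (erule down.copy_sets_grid up.copy_sets_grid)+

lemma card_Pats_all: "u \<noteq> [] \<Longrightarrow> S \<in> Pats_all n N u \<Longrightarrow> card S = length u"
  by (erule (1) Pats_all_copy_set) (erule down.card_copy_set up.card_copy_set)+

lemma feasible_iff:
  assumes u: "u \<noteq> []"
  shows "feasible n N u x y \<longleftrightarrow> structural_constraints n N u x y \<and>
    down.insertion_constraints n N u x y \<and> up.insertion_constraints n N u x y"
proof -
  define r where "r = int (card (set u))"
  have A: "A_at n N u i j \<union> A_plus n N u i j =
      {S \<in> down.copy_sets n N u (length u) \<union> down.copy_sets n N u (length u - 1). (i, j) \<in> S}"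
    "A_at n N u i j \<union> A_minus n N u i j =
      {S \<in> up.copy_sets n N u (length u) \<union> up.copy_sets n N u (length u - 1). (i, j) \<in> S}" for i j
    unfolding A_at_def A_plus_def A_minus_def Pats_plus_eq[OF u] Pats_minus_eq[OF u]
      down.Pats_eq copy_sets_full_down_up by blast+
  have T: "{t \<in> {1..n}. i < t} = {i + 1..n}" "{t \<in> {1..n}. t < i} = {1..i - 1}" if "i \<in> {1..n}" for i
    using that by auto
  have slack:
    "down.insertion_slack n N u x y i j (j - 1) =
       (\<Sum>P'\<in>A_at n N u i j \<union> A_plus n N u i j. y P') - (\<Sum>t=i+1..n. x t j)
           + (\<Sum>t=int j - r + 1..int j + r - 2. xz N x i t)"
    "down.insertion_slack n N u x y i j j =
       (\<Sum>P'\<in>A_at n N u i j \<union> A_plus n N u i j. y P') - (\<Sum>t=1..i-1. x t j)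
           + (\<Sum>t=int j - r + 2..int j + r - 1. xz N x i t)"
    "up.insertion_slack n N u x y i j j =
       (\<Sum>P'\<in>A_at n N u i j \<union> A_minus n N u i j. y P') - (\<Sum>t=i+1..n. x t j)
           + (\<Sum>t=int j - r + 2..int j + r - 1. xz N x i t)"
    "up.insertion_slack n N u x y i j (j - 1) =
       (\<Sum>P'\<in>A_at n N u i j \<union> A_minus n N u i j. y P') - (\<Sum>t=1..i-1. x t j)
           + (\<Sum>t=int j - r + 1..int j + r - 2. xz N x i t)"
    if i: "i \<in> {1..n}" and j: "j \<in> {1..N}" for i j
  proof -
    have "int (j - 1) - r + 2 = int j - r + 1" "int (j - 1) + r - 1 = int j + r - 2" "j - 1 < j" "\<not> j < j"
      using j by auto
    then show
      "down.insertion_slack n N u x y i j (j - 1) =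
         (\<Sum>P'\<in>A_at n N u i j \<union> A_plus n N u i j. y P') - (\<Sum>t=i+1..n. x t j)
             + (\<Sum>t=int j - r + 1..int j + r - 2. xz N x i t)"
      "down.insertion_slack n N u x y i j j =
         (\<Sum>P'\<in>A_at n N u i j \<union> A_plus n N u i j. y P') - (\<Sum>t=1..i-1. x t j)
             + (\<Sum>t=int j - r + 2..int j + r - 1. xz N x i t)"
      "up.insertion_slack n N u x y i j j =
         (\<Sum>P'\<in>A_at n N u i j \<union> A_minus n N u i j. y P') - (\<Sum>t=i+1..n. x t j)
             + (\<Sum>t=int j - r + 2..int j + r - 1. xz N x i t)"
      "up.insertion_slack n N u x y i j (j - 1) =
         (\<Sum>P'\<in>A_at n N u i j \<union> A_minus n N u i j. y P') - (\<Sum>t=1..i-1. x t j)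
             + (\<Sum>t=int j - r + 1..int j + r - 2. xz N x i t)"
      unfolding down.insertion_slack_def up.insertion_slack_def A r_def[symmetric]
      by (simp_all only: if_True if_False T[OF i])
  qed
  have ins: "down.insertion_constraints n N u x y \<and> up.insertion_constraints n N u x y \<longleftrightarrow>
      (\<forall>i\<in>{1..n}. \<forall>j\<in>{1..N}. 0 \<le> down.insertion_slack n N u x y i j (j - 1)) \<and>
      (\<forall>i\<in>{1..n}. \<forall>j\<in>{1..N}. 0 \<le> down.insertion_slack n N u x y i j j) \<and>
      (\<forall>i\<in>{1..n}. \<forall>j\<in>{1..N}. 0 \<le> up.insertion_slack n N u x y i j j) \<and>
      (\<forall>i\<in>{1..n}. \<forall>j\<in>{1..N}. 0 \<le> up.insertion_slack n N u x y i j (j - 1))"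
    unfolding down.insertion_constraints_def up.insertion_constraints_def by blast
  show ?thesis
    unfolding ins
    by (simp only: slack feasible_def structural_constraints_def Let_def r_def ball_conj_distrib cong: ball_cong) argo
qed

text \<open>
  Every gap of a nonempty word is next to some letter, so its insertions are covered by a column.
  Inserting a letter next to an equal one violates sparsity as \<open>r \<ge> 2\<close>; otherwise the two rows differ and
  one of the two reading directions applies.
\<close>

lemma insertion_constraints_iff:
  assumes enc: "encodes n N x s" and len: "0 < length s"
    and u: "card (set u) \<ge> 2" and sp: "sparse (card (set u)) s" and av: "avoids s u"
    and y: "\<And>S. S \<in> Pats_all n N u \<Longrightarrow> y S = of_bool (int (length u) - 1 \<le> f_val x S)"
  shows "down.insertion_constraints n N u x y \<and> up.insertion_constraints n N u x y \<longleftrightarrow>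
    saturated {1..n} u s"
proof -
  define bad where "bad a k \<longleftrightarrow>
    \<not> sparse (card (set u)) (insert_at k a s) \<or> contains_copy (insert_at k a s) u" for a k
  have u0: "u \<noteq> []" using u by auto
  have s: "set s \<subseteq> {1..n}" "length s \<le> N" using enc by (simp_all add: encodes_def)
  have sat: "saturated {1..n} u s \<longleftrightarrow> (\<forall>a\<in>{1..n}. \<forall>k\<le>length s. bad a k)"
    using s sp av unfolding saturated_def bad_def by blast
  have u1: "1 \<le> card (set u)" using u by simp
  have yd: "y S = of_bool (int (length u) - 1 \<le> f_val x S)"
    if "S \<in> down.copy_sets n N u (length u) \<union> down.copy_sets n N u (length u - 1)" for S
    using that by (intro y) (auto simp: Pats_all_def down.Pats_eq Pats_plus_eq[OF u0])
  have yu: "y S = of_bool (int (length u) - 1 \<le> f_val x S)"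
    if "S \<in> up.copy_sets n N u (length u) \<union> up.copy_sets n N u (length u - 1)" for S
    using that by (intro y) (auto simp: Pats_all_def up.Pats_eq Pats_minus_eq[OF u0])
  note d = down.insertion_slack_nonneg_iff[OF enc sp av u1 yd, folded bad_def]
    and p = up.insertion_slack_nonneg_iff[OF enc sp av u1 yu, folded bad_def]
  show ?thesis
  proof
    assume L: "down.insertion_constraints n N u x y \<and> up.insertion_constraints n N u x y"
    show "saturated {1..n} u s"
      unfolding sat
    proof (intro ballI allI impI)
      fix a k assume a: "a \<in> {1..n}" and k: "k \<le> length s"
      \<comment> \<open>The neighbour is the letter after the gap, except at the end of the word.\<close>
      define j where "j = (if k < length s then Suc k else length s)"
      have jk: "j = Suc k \<or> j = k" and j1: "1 \<le> j" "j \<le> length s" using k len by (auto simp: j_def Suc_le_eq)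
      then have jN: "j \<in> {1..N}" using s by auto
      show "bad a k"
      proof (cases "s ! (j - 1) = a")
        case True
        have "\<not> sparse (card (set u)) (insert_at k a s)"
          using True jk j1 u k sparse_insert_at_iff[OF sp k u1, of a]
          by (auto intro!: exI[of _ "j - 1"])
        then show ?thesis by (simp add: bad_def)
      next
        case False
        then have "down.fits s a j k \<or> up.fits s a j k"
          using jk by (auto simp: down.fits_def up.fits_def)
        moreover have "0 \<le> down.insertion_slack n N u x y a j k" "0 \<le> up.insertion_slack n N u x y a j k"
        proof -
          have "k = j - 1 \<or> k = j" using jk by auto
          then show "0 \<le> down.insertion_slack n N u x y a j k" "0 \<le> up.insertion_slack n N u x y a j k"
            using L a jN unfolding down.insertion_constraints_def up.insertion_constraints_def by auto
        qed
        ultimately show ?thesis using d[OF _ a jN jk] p[OF _ a jN jk] j1 by blast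
      qed
    qed
  next
    assume "saturated {1..n} u s"
    then have bad: "bad a k" if "a \<in> {1..n}" "k \<le> length s" for a k using that unfolding sat by blast
    have "0 \<le> down.insertion_slack n N u x y i j k \<and> 0 \<le> up.insertion_slack n N u x y i j k"
      if i: "i \<in> {1..n}" and j: "j \<in> {1..N}" and k: "j = Suc k \<or> j = k" for i j k
    proof -
      have "j \<le> length s \<longrightarrow> bad i k" using bad i k by auto
      then show ?thesis using d[OF _ i j k] p[OF _ i j k] by blast
    qed
    then show "down.insertion_constraints n N u x y \<and> up.insertion_constraints n N u x y"
      unfolding down.insertion_constraints_def up.insertion_constraints_def by auto
  qed
qed

text \<open>
  The linear constraints on a selector make it the indicator of "at most one cell is missing",
  provided that no copy is complete.
\<close>

lemma copy_selector_iff: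
  fixes l f v :: int
  assumes "2 \<le> l" "0 \<le> f" "f < l"
  shows "v \<in> {0, 1} \<and> (l - 1) * v - f \<le> 0 \<and> v - f \<ge> - l + 2 \<longleftrightarrow> v = of_bool (l - 1 \<le> f)"
  using assms by (auto simp: of_bool_def)

lemma structural_constraints_iff:
  assumes enc: "encodes n N x s" and u: "card (set u) \<ge> 2" and N: "card (set u) \<le> N"
  shows "structural_constraints n N u x y \<longleftrightarrow>
    sparse (card (set u)) s \<and> avoids s u \<and>
    (\<forall>S\<in>Pats_all n N u. y S = of_bool (int (length u) - 1 \<le> f_val x S)) \<and>
    (\<forall>i\<in>{1..card (set u) - 1}. x i i = 1)"
proof -
  have u0: "u \<noteq> []" using u by auto
  have s: "set s \<subseteq> {1..n}" "length s \<le> N" using enc by (simp_all add: encodes_def)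
  have l: "2 \<le> length u" using u card_length[of u] by linarith
  have full: "f_val x S < int (length u) \<longleftrightarrow> \<not> S \<subseteq> set (word_cells s)"
    if "S \<subseteq> {1..n} \<times> {1..N}" "card S = length u" for S
  proof -
    have fin: "finite S" using that(1) by (rule finite_subset) simp
    have "S \<subseteq> set (word_cells s) \<longleftrightarrow> S \<inter> set (word_cells s) = S" by blast
    also have "\<dots> \<longleftrightarrow> card (S \<inter> set (word_cells s)) = card S"
      using fin by (metis card_subset_eq inf_le1)
    finally have "S \<subseteq> set (word_cells s) \<longleftrightarrow> card (S \<inter> set (word_cells s)) = card S" .
    moreover have "card (S \<inter> set (word_cells s)) \<le> card S" using fin by (intro card_mono) auto
    ultimately show ?thesis using f_val_encodes[OF enc that(1)] that(2) by auto
  qed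
  have grid: "S \<subseteq> {1..n} \<times> {1..N}" "card S = length u" if "S \<in> Pats_all n N u" for S
    using Pats_all_grid[OF u0 that] card_Pats_all[OF u0 that] by auto
  have avoid: "(\<forall>S\<in>Pats n N u. f_val x S < int (length u)) \<longleftrightarrow> avoids s u"
  proof -
    have "contains_copy s u \<longleftrightarrow> (\<exists>S\<in>Pats n N u. S \<subseteq> set (word_cells s))"
      unfolding down.contains_copy_word_iff[OF s] down.Pats_eq
      by (metis down.copy_set_in_word_columns)
    moreover have "f_val x S < int (length u) \<longleftrightarrow> \<not> S \<subseteq> set (word_cells s)" if "S \<in> Pats n N u" for S
      using that by (intro full grid) (simp_all add: Pats_all_def)
    ultimately show ?thesis by auto
  qed
  have lt_l: "f_val x S < int (length u)" if "avoids s u" "S \<in> Pats_all n N u" for S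
  proof -
    have "\<not> S \<subseteq> set (word_cells s)"
      using u0 that(2)
    proof (cases rule: Pats_all_copy_set)
      case (1 m)
      then show ?thesis using that(1) down.contains_copy_word_iff[OF s, of u] by blast
    next
      case (2 m)
      then show ?thesis using that(1) up.contains_copy_word_iff[OF s, of u] by blast
    qed
    then show ?thesis using full[OF grid[OF that(2)]] by simp
  qed
  have f0: "0 \<le> f_val x S" if "S \<in> Pats_all n N u" for S
    using f_val_encodes[OF enc grid(1)[OF that]] by simp
  have selectors: "(\<forall>S\<in>Pats_all n N u. y S \<in> {0, 1} \<and> (int (length u) - 1) * y S - f_val x S \<le> 0 \<and>
      y S - f_val x S \<ge> - int (length u) + 2) \<longleftrightarrow>
    (\<forall>S\<in>Pats_all n N u. y S = of_bool (int (length u) - 1 \<le> f_val x S))" if "avoids s u"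
    using l by (intro ball_cong refl copy_selector_iff lt_l[OF that] f0) auto
  have col: "(\<Sum>i=1..n. x i j) = of_bool (j \<le> length s)" if "j \<in> {1..N}" for j
  proof -
    have "s ! (j - 1) \<in> {1..n}" if "j \<le> length s"
      using encodes_letter[OF enc _ that] \<open>j \<in> {1..N}\<close> by simp
    then show ?thesis using sum_column_encodes[OF enc subset_refl that] by auto
  qed
  have cols: "\<forall>j\<in>{1..N}. (\<Sum>i=1..n. x i j) \<le> 1" using col by simp
  have mono: "\<forall>j\<in>{1..N - 1}. (\<Sum>i=1..n. x i j) \<ge> (\<Sum>i=1..n. x i (j + 1))"
  proof
    fix j assume "j \<in> {1..N - 1}"
    then have "j \<in> {1..N}" "j + 1 \<in> {1..N}" by auto
    then show "(\<Sum>i=1..n. x i j) \<ge> (\<Sum>i=1..n. x i (j + 1))" using col[of j] col[of "j + 1"] by simp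
  qed
  have x01: "\<forall>i\<in>{1..n}. \<forall>j\<in>{1..N}. x i j \<in> {0, 1}" using enc by (auto simp: encodes_def)
  have sparse: "(\<forall>i\<in>{1..n}. \<forall>j\<in>{1..N + 1 - card (set u)}.
      (\<Sum>t=int j..int j + int (card (set u)) - 1. xz N x i t) \<le> 1) \<longleftrightarrow> sparse (card (set u)) s"
    using u N by (intro sparse_iff_windows[OF enc]) auto
  show ?thesis
    unfolding structural_constraints_def Let_def sparse avoid using selectors cols mono x01 by blast
qed

lemma feasible_iff_saturated:
  assumes enc: "encodes n N x s" and len: "0 < length s" and u: "card (set u) \<ge> 2" and N: "card (set u) \<le> N"
  shows "feasible n N u x y \<longleftrightarrow> saturated {1..n} u s \<and>
    (\<forall>S\<in>Pats_all n N u. y S = of_bool (int (length u) - 1 \<le> f_val x S)) \<and>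
    (\<forall>i\<in>{1..card (set u) - 1}. x i i = 1)"
proof -
  have "u \<noteq> []" using u by auto
  note feasible_iff[OF this, of n N x y] structural_constraints_iff[OF enc u N, of y]
    insertion_constraints_iff[OF enc len u, of y]
  then show ?thesis by (auto simp: saturated_def)
qed

lemma objective_encodes:
  assumes enc: "encodes n N x s"
  shows "objective n N x = int (length s)"
proof -
  have s: "set s \<subseteq> {1..n}" "length s \<le> N" using enc by (simp_all add: encodes_def)
  have "objective n N x = f_val x ({1..n} \<times> {1..N})"
    unfolding objective_def f_val_def by (simp add: sum.cartesian_product)
  also have "\<dots> = int (card (set (word_cells s)))"
    using word_cells_grid[OF s] by (simp add: f_val_encodes[OF enc] Int_absorb1)
  also have "card (set (word_cells s)) = length s"
    using down.sorted_before_distinct[OF down.sorted_word_cells, of s] by (simp add: distinct_card)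
  finally show ?thesis .
qed

lemma prefix_of_decreasing:
  fixes P :: "nat \<Rightarrow> bool"
  assumes "\<And>j. 1 \<le> j \<Longrightarrow> j < N \<Longrightarrow> P (Suc j) \<Longrightarrow> P j"
  shows "\<exists>L\<le>N. \<forall>j\<in>{1..N}. P j \<longleftrightarrow> j \<le> L"
  using assms
proof (induction N)
  case (Suc N)
  then obtain L where L: "L \<le> N" "\<forall>j\<in>{1..N}. P j \<longleftrightarrow> j \<le> L" by auto
  show ?case
  proof (cases "P (Suc N)")
    case True
    have "L = N"
    proof (cases "N = 0")
      case False
      then have "P N" using True Suc.prems[of N] by simp
      then show ?thesis using L False by auto
    qed (use L in simp)
    then show ?thesis using True L by (intro exI[of _ "Suc N"]) (auto simp: le_Suc_eq)
  next
    case False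
    then show ?thesis using L by (intro exI[of _ L]) (auto simp: le_Suc_eq)
  qed
qed simp

text \<open>
  The columns hold at most one letter each, and an empty column is followed by empty columns only.
  Hence the nonempty columns form an initial segment and spell a word.
\<close>

lemma structural_constraints_encodes:
  assumes st: "structural_constraints n N u x y" and u: "card (set u) \<ge> 2" and n: "card (set u) \<le> n" and N: "card (set u) \<le> N"
  shows "\<exists>s. encodes n N x s \<and> 0 < length s"
proof -
  have x01: "x i j \<in> {0, 1}" if "i \<in> {1..n}" "j \<in> {1..N}" for i j
    using st that by (simp add: structural_constraints_def Let_def)
  have col: "(\<Sum>i=1..n. x i j) \<le> 1" if "j \<in> {1..N}" for j
    using st that by (simp add: structural_constraints_def Let_def)
  have mono: "(\<Sum>i=1..n. x i (Suc j)) \<le> (\<Sum>i=1..n. x i j)" if "j \<in> {1..N - 1}" for j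
    using st that by (simp add: structural_constraints_def Let_def)
  have x11: "x 1 1 = 1"
    using st u by (auto simp: structural_constraints_def Let_def)
  define P where "P j \<longleftrightarrow> (\<exists>i\<in>{1..n}. x i j = 1)" for j
  have nonneg: "0 \<le> x i j" if "i \<in> {1..n}" "j \<in> {1..N}" for i j using x01[OF that] by auto
  have P_iff: "P j \<longleftrightarrow> 0 < (\<Sum>i=1..n. x i j)" if j: "j \<in> {1..N}" for j
  proof -
    have "(\<Sum>i=1..n. x i j) = 0 \<longleftrightarrow> (\<forall>i\<in>{1..n}. x i j = 0)"
      using nonneg j by (intro sum_nonneg_eq_0_iff) auto
    moreover have "0 \<le> (\<Sum>i=1..n. x i j)" using nonneg j by (intro sum_nonneg) auto
    moreover have "P j \<longleftrightarrow> \<not> (\<forall>i\<in>{1..n}. x i j = 0)" unfolding P_def using x01 j by force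
    ultimately show ?thesis by linarith
  qed
  have "\<exists>L\<le>N. \<forall>j\<in>{1..N}. P j \<longleftrightarrow> j \<le> L"
  proof (rule prefix_of_decreasing)
    fix j assume j: "1 \<le> j" "j < N" "P (Suc j)"
    then have "j \<in> {1..N - 1}" by auto
    then show "P j" using j mono[of j] P_iff[of j] P_iff[of "Suc j"] by auto
  qed
  then obtain L where L: "L \<le> N" "\<And>j. j \<in> {1..N} \<Longrightarrow> P j \<longleftrightarrow> j \<le> L" by blast
  have "\<forall>j. \<exists>i. P j \<longrightarrow> i \<in> {1..n} \<and> x i j = 1" unfolding P_def by blast
  then obtain c where c: "\<And>j. P j \<Longrightarrow> c j \<in> {1..n} \<and> x (c j) j = 1" by metis
  have unique: "i = c j" if i: "i \<in> {1..n}" and j: "j \<in> {1..N}" and one: "x i j = 1" for i j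
  proof (rule ccontr)
    assume ne: "i \<noteq> c j"
    have "P j" using i one unfolding P_def by blast
    then have cj: "c j \<in> {1..n}" "x (c j) j = 1" using c by blast+
    have "(\<Sum>t\<in>{i, c j}. x t j) \<le> (\<Sum>t=1..n. x t j)"
      using i cj(1) nonneg j by (intro sum_mono2) auto
    then show False using col[OF j] ne one cj(2) by simp
  qed
  define s where "s = map c [1..<Suc L]"
  have len: "length s = L" by (simp add: s_def)
  have nth: "s ! (j - 1) = c j" if "1 \<le> j" "j \<le> L" for j
    using that by (simp add: s_def del: upt_Suc)
  have "encodes n N x s"
    unfolding encodes_def
  proof (intro conjI ballI)
    show "set s \<subseteq> {1..n}" using c L by (auto simp: s_def simp del: upt_Suc)
    show "length s \<le> N" using L by (simp add: len)
    fix i j assume i: "i \<in> {1..n}" and j: "j \<in> {1..N}"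
    show "x i j = of_bool ((i, j) \<in> set (word_cells s))"
    proof (cases "j \<le> L")
      case True
      then have "P j" using L j by blast
      then have "x i j = 1 \<longleftrightarrow> i = c j" using unique[OF i j] c by blast
      then show ?thesis using x01[OF i j] True j nth[of j] by (auto simp: in_word_cells_iff len)
    next
      case False
      then have "\<not> P j" using L j by blast
      then show ?thesis using x01[OF i j] i False by (auto simp: P_def in_word_cells_iff len)
    qed
  qed
  moreover have "0 < length s"
  proof -
    have "P 1" using x11 u n by (auto simp: P_def intro!: bexI[of _ 1])
    then show ?thesis using L(2)[of 1] u N by (simp add: len)
  qed
  ultimately show ?thesis by blast
qed

theorem theorem8:
  fixes u :: "'a list" and n N :: nat
  assumes "card (set u) \<ge> 2"
    and "n \<ge> card (set u)"
    and "N > Sat n u"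
  shows "(\<forall>i\<in>{1..n}. \<forall>j\<in>{1..N}. A_at n N u i j \<noteq> {}) \<and>
         (\<forall>P'\<in>Pats_all n N u. card P' = length u) \<and>
         is_minimum {objective n N x | x y. feasible n N u x y} (int (Sat n u))"
proof -
  have u0: "u \<noteq> []" using assms(1) by auto
  obtain s0 :: "nat list" where "saturated {1..n} u s0" "length s0 = Sat n u"
    using saturated_Sat[OF u0] by blast
  then obtain s where sat: "saturated {1..n} u s" and len: "length s = Sat n u"
    and start: "\<And>p. p < card (set u) - 1 \<Longrightarrow> s ! p = Suc p"
    using saturated_normalise[of n u s0] assms(1,2) by fastforce
  have lu: "length u \<le> Suc (length s)"
    using saturated_length[OF sat] assms(1,2) by simp
  have lN: "length u \<le> N" using lu len assms(3) by simp
  have ru: "card (set u) \<le> length u" by (rule card_length)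
  have rN: "card (set u) \<le> N" using ru lN by simp
  have s0: "0 < length s" using lu ru assms(1) by linarith
  have "A_at n N u i j \<noteq> {}" if "i \<in> {1..n}" "j \<in> {1..N}" for i j
    using down.copy_set_through_cell[OF u0 assms(2) lN that]
    unfolding A_at_def down.Pats_eq by blast
  moreover have "card S = length u" if "S \<in> Pats_all n N u" for S
    using card_Pats_all[OF u0 that] .
  moreover have "int (Sat n u) \<in> {objective n N x | x y. feasible n N u x y}"
  proof -
    define x :: "nat \<Rightarrow> nat \<Rightarrow> int" where "x i j = of_bool ((i, j) \<in> set (word_cells s))" for i j
    define y :: "(nat \<times> nat) set \<Rightarrow> int" where "y S = of_bool (int (length u) - 1 \<le> f_val x S)" for S
    have enc: "encodes n N x s"
      using sat len assms(3) by (simp add: encodes_def x_def saturated_def)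
    have "x i i = 1" if "i \<in> {1..card (set u) - 1}" for i
      using that start[of "i - 1"] lu ru by (auto simp: x_def in_word_cells_iff)
    then have "feasible n N u x y"
      unfolding feasible_iff_saturated[OF enc s0 assms(1) rN] using sat by (simp add: y_def)
    moreover have "int (Sat n u) = objective n N x" using objective_encodes[OF enc] len by simp
    ultimately show ?thesis by blast
  qed
  moreover have "int (Sat n u) \<le> objective n N x" if feas: "feasible n N u x y" for x y
  proof -
    have "structural_constraints n N u x y" using feas feasible_iff[OF u0] by blast
    then obtain t where enc: "encodes n N x t" and t: "0 < length t"
      using structural_constraints_encodes[OF _ assms(1,2) rN] by blast
    have "saturated {1..n} u t" using feas feasible_iff_saturated[OF enc t assms(1) rN] by blast
    then show ?thesis using Sat_le objective_encodes[OF enc] by fastforce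
  qed
  ultimately show ?thesis unfolding is_minimum_def by blast
qed

end
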